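(* Let $\sigma_x,\sigma_k>0$, let $L(x,k)\in\left(\mathcal{S}'(\mathbb{R}^{2n})\right)^{d\times d}$, let $L=L(x,\partial_x)$ be the matrix of operators with matrix-valued Weyl symbol $L(x,k)$, and let $u_0\in\left(\mathcal{S}(\mathbb{R}^n)\right)^d$. Let $u(x,t)$, with $t\mapsto u(\cdot,t)$ continuously differentiable with values in $\left(\mathcal{S}(\mathbb{R}^n)\right)^d$, solve the initial value problem $$u_t(x,t)+Lu(x,t)=0,\qquad u(x,0)=u_0(x).$$ Then the smoothed Wigner transform of $u$, $\tilde W(x,k,t)=\tilde W[u(\cdot,t)](x,k)$, satisfies the initial value problem $$\tilde W_t(x,k,t)+2\mathcal{H}\left(\tilde{\mathcal{L}}\,\tilde W(x,k,t)\right)=0,\qquad \tilde W(x,k,0)=\tilde W[u_0](x,k),$$ where $\mathcal{H}(A)=\frac{A+A^*}{2}$ denotes the Hermitian part of a matrix.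
   Context: Fourier transform: $\hat f(k)=\int_{\mathbb{R}^n}e^{-2\pi i k\cdot x}f(x)\,dx$. An operator with (scalar) Weyl symbol $a(x,k)$ is $f\mapsto\int_{y,k\in\mathbb{R}^n}e^{2\pi i k(x-y)}a\left(\frac{x+y}{2},k\right)f(y)\,dy\,dk$; for matrices, entrywise. The smoothed Wigner transform of scalar functions is $$\tilde W[f,g](x,k)=\left(\frac{\sqrt2}{\sigma_x}\right)^n\int_{u,y\in\mathbb{R}^n}e^{-2\pi i k y-\frac{\pi\sigma_k^2y^2}{2}-\frac{2\pi(u-x)^2}{\sigma_x^2}}\,f\left(u+\frac y2\right)\bar g\left(u-\frac y2\right)du\,dy;$$ for vectors $f,g:\mathbb{R}^n\to\mathbb{C}^d$ it is the $d\times d$ matrix with entries $\tilde W[f,g]_{i,j}=\tilde W[f_i,g_j]$, and $\tilde W[u]=\tilde W[u,u]$. $\tilde{\mathcal{L}}$ is the $d\times d$ matrix of operators $\tilde{\mathcal{L}}_{i,j}$, where $$\tilde{\mathcal{L}}_{i,j}w(x,k)=\int_{S,T\in\mathbb{R}^n}\hat L_{i,j}(S,T)\,e^{2\pi i(Sx+Tk)-\frac{\pi}{2}(\sigma_x^2S^2+\sigma_k^2T^2)}\,w\left(x+\frac{T+i\sigma_x^2S}{2},k-\frac{S-i\sigma_k^2T}{2}\right)dS\,dT,$$ $\hat L_{i,j}$ being the Fourier transform of $L_{i,j}(x,k)$ in both variables, and the integral a duality pairing; it acts on $w=\tilde W[f,g]$ with $f,g\in\mathcal{S}(\mathbb{R}^n)$,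 which extends to an entire function. $\tilde{\mathcal{L}}\tilde W$ is the matrix product, $(\tilde{\mathcal{L}}\tilde W)_{i,j}=\sum_l\tilde{\mathcal{L}}_{i,l}\tilde W_{l,j}$. *)

theory Defs
  imports "HOL-Analysis.Analysis"
begin

section \<open>Schwartz functions and tempered distributions\<close>

text \<open>Iterated directional derivative; with basis vectors in the list, these are the partial
  derivatives \<open>\<partial>\<^sup>\<beta> f\<close>.\<close>

fun partials :: "'a::euclidean_space list \<Rightarrow> ('a \<Rightarrow> complex) \<Rightarrow> 'a \<Rightarrow> complex" where
  "partials [] f = f"
| "partials (v # vs) f = (\<lambda>x. frechet_derivative (partials vs f) (at x) v)"

definition smooth :: "('a::euclidean_space \<Rightarrow> complex) \<Rightarrow> bool" where
  "smooth f \<longleftrightarrow> (\<forall>vs. set vs \<subseteq> Basis \<longrightarrow> (\<forall>x. partials vs f differentiable (at x)))"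

definition schwartz :: "('a::euclidean_space \<Rightarrow> complex) \<Rightarrow> bool" where
  "schwartz f \<longleftrightarrow> smooth f \<and>
     (\<forall>m vs. set vs \<subseteq> Basis \<longrightarrow> bdd_above (range (\<lambda>x. (1 + norm x) ^ m * norm (partials vs f x))))"

text \<open>The supremum is meaningful only for Schwartz functions, where it is finite.\<close>

definition schwartz_seminorm ::
  "nat \<Rightarrow> 'a::euclidean_space list \<Rightarrow> ('a \<Rightarrow> complex) \<Rightarrow> real" where
  "schwartz_seminorm m vs f = (SUP x. (1 + norm x) ^ m * norm (partials vs f x))"

definition schwartz_tendsto ::
  "('t \<Rightarrow> 'a::euclidean_space \<Rightarrow> complex) \<Rightarrow> ('a \<Rightarrow> complex) \<Rightarrow> 't filter \<Rightarrow> bool" where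
  "schwartz_tendsto \<phi> l F \<longleftrightarrow>
     (\<forall>m vs. set vs \<subseteq> Basis \<longrightarrow> ((\<lambda>t. schwartz_seminorm m vs (\<lambda>x. \<phi> t x - l x)) \<longlongrightarrow> 0) F)"

text \<open>\<open>v\<close> is a continuously differentiable curve in the Schwartz space on the time set \<open>I\<close>,
  with derivative \<open>v'\<close> (one-sided at endpoints of \<open>I\<close>); both limits are in the topology of
  the Schwartz space.\<close>

definition schwartz_C1_on ::
  "real set \<Rightarrow> (real \<Rightarrow> 'a::euclidean_space \<Rightarrow> complex) \<Rightarrow> (real \<Rightarrow> 'a \<Rightarrow> complex) \<Rightarrow> bool" where
  "schwartz_C1_on I v v' \<longleftrightarrow>
     (\<forall>t\<in>I. schwartz (v t) \<and> schwartz (v' t) \<and>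
        schwartz_tendsto (\<lambda>s x. (v s x - v t x) / complex_of_real (s - t)) (v' t) (at t within I) \<and>
        schwartz_tendsto v' (v' t) (at t within I))"

text \<open>A tempered distribution is a functional on all functions of which only the values at
  Schwartz functions matter. The pairing is bilinear (no complex conjugation).\<close>

definition tempered :: "(('a::euclidean_space \<Rightarrow> complex) \<Rightarrow> complex) \<Rightarrow> bool" where
  "tempered T \<longleftrightarrow>
     (\<forall>\<phi> \<psi>. schwartz \<phi> \<longrightarrow> schwartz \<psi> \<longrightarrow> T (\<lambda>x. \<phi> x + \<psi> x) = T \<phi> + T \<psi>) \<and>
     (\<forall>c \<phi>. schwartz \<phi> \<longrightarrow> T (\<lambda>x. c * \<phi> x) = c * T \<phi>) \<and>
     (\<exists>C N. \<forall>\<phi>. schwartz \<phi> \<longrightarrow>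
        norm (T \<phi>) \<le> C * (\<Sum>vs | set vs \<subseteq> Basis \<and> length vs \<le> N. schwartz_seminorm N vs \<phi>))"

definition regular_dist :: "('a::euclidean_space \<Rightarrow> complex) \<Rightarrow> ('a \<Rightarrow> complex) \<Rightarrow> complex" where
  "regular_dist f \<phi> = (LINT x|lborel. f x * \<phi> x)"

definition fourier :: "('a::euclidean_space \<Rightarrow> complex) \<Rightarrow> 'a \<Rightarrow> complex" where
  "fourier f k = (LINT x|lborel. exp (- 2 * of_real pi * \<i> * of_real (k \<bullet> x)) * f x)"

definition fourier_dist ::
  "(('a::euclidean_space \<Rightarrow> complex) \<Rightarrow> complex) \<Rightarrow> ('a \<Rightarrow> complex) \<Rightarrow> complex" where
  "fourier_dist T \<phi> = T (fourier \<phi>)"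

section \<open>Weyl operators\<close>

type_synonym 'n phase = "(real^'n) \<times> (real^'n)"

text \<open>For a tempered symbol \<open>a\<close> the Weyl operator maps Schwartz functions to tempered
  distributions. Pairing \<open>\<integral>\<integral> exp(2\<pi>i k(x-y)) a((x+y)/2, k) f(y) dy dk\<close> with a test function
  \<open>\<phi>(x)\<close> and substituting \<open>x = X + z/2\<close>, \<open>y = X - z/2\<close> gives the formula below.\<close>

definition weyl_op ::
  "(('n::finite phase \<Rightarrow> complex) \<Rightarrow> complex) \<Rightarrow> (real^'n \<Rightarrow> complex) \<Rightarrow>
   (real^'n \<Rightarrow> complex) \<Rightarrow> complex" where
  "weyl_op a f \<phi> =
     a (\<lambda>(X, k). LINT z|lborel. exp (2 * of_real pi * \<i> * of_real (k \<bullet> z)) *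
          f (X - (1/2) *\<^sub>R z) * \<phi> (X + (1/2) *\<^sub>R z))"

definition weyl_matrix_op ::
  "(('n::finite phase \<Rightarrow> complex) \<Rightarrow> complex)^'d::finite^'d \<Rightarrow> (real^'n \<Rightarrow> complex^'d) \<Rightarrow>
   ((real^'n \<Rightarrow> complex) \<Rightarrow> complex)^'d" where
  "weyl_matrix_op L f = (\<chi> i. (\<lambda>\<phi>. \<Sum>j\<in>UNIV. weyl_op (L $ i $ j) (\<lambda>x. f x $ j) \<phi>))"

section \<open>The smoothed Wigner transform\<close>

definition smoothed_wigner ::
  "real \<Rightarrow> real \<Rightarrow> (real^'n::finite \<Rightarrow> complex) \<Rightarrow> (real^'n \<Rightarrow> complex) \<Rightarrow> 'n phase \<Rightarrow> complex" where
  "smoothed_wigner \<sigma>x \<sigma>k f g = (\<lambda>(x, k).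
     of_real ((sqrt 2 / \<sigma>x) ^ CARD('n)) *
     (LINT (v, y)|lborel.
        exp (- 2 * of_real pi * \<i> * of_real (k \<bullet> y)
             - of_real (pi * \<sigma>k\<^sup>2 * (norm y)\<^sup>2 / 2)
             - of_real (2 * pi * (norm (v - x))\<^sup>2 / \<sigma>x\<^sup>2)) *
        f (v + (1/2) *\<^sub>R y) * cnj (g (v - (1/2) *\<^sub>R y))))"

definition smoothed_wigner_matrix ::
  "real \<Rightarrow> real \<Rightarrow> (real^'n::finite \<Rightarrow> complex^'d::finite) \<Rightarrow> (real^'n \<Rightarrow> complex^'d) \<Rightarrow>
   'n phase \<Rightarrow> complex^'d^'d" where
  "smoothed_wigner_matrix \<sigma>x \<sigma>k f g p =
     (\<chi> i j. smoothed_wigner \<sigma>x \<sigma>k (\<lambda>x. f x $ i) (\<lambda>x. g x $ j) p)"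

section \<open>The smoothed operators on phase space\<close>

text \<open>Entire means complex Frechet differentiable everywhere, i.e. the real derivative is
  complex linear.\<close>

definition entire :: "((complex^'n::finite) \<times> (complex^'n) \<Rightarrow> complex) \<Rightarrow> bool" where
  "entire F \<longleftrightarrow> (\<forall>p. \<exists>D. (F has_derivative D) (at p) \<and>
                     (\<forall>c a b. D (c *s a, c *s b) = c * D (a, b)))"

text \<open>Well defined whenever an entire extension exists, by the identity theorem.\<close>

definition entire_extension ::
  "('n::finite phase \<Rightarrow> complex) \<Rightarrow> (complex^'n) \<times> (complex^'n) \<Rightarrow> complex" where
  "entire_extension w = (THE F. entire F \<and>
     (\<forall>x k. F (\<chi> j. of_real (x $ j), \<chi> j. of_real (k $ j)) = w (x, k)))"

definition smoothed_op ::
  "real \<Rightarrow> real \<Rightarrow> (('n::finite phase \<Rightarrow> complex) \<Rightarrow> complex) \<Rightarrow>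
   ('n phase \<Rightarrow> complex) \<Rightarrow> 'n phase \<Rightarrow> complex" where
  "smoothed_op \<sigma>x \<sigma>k a w = (\<lambda>(x, k).
     fourier_dist a (\<lambda>(S, T).
       exp (2 * of_real pi * \<i> * of_real (S \<bullet> x + T \<bullet> k)
            - of_real (pi / 2 * (\<sigma>x\<^sup>2 * (norm S)\<^sup>2 + \<sigma>k\<^sup>2 * (norm T)\<^sup>2))) *
       entire_extension w
         (\<chi> j. of_real (x $ j) + (of_real (T $ j) + \<i> * of_real (\<sigma>x\<^sup>2 * S $ j)) / 2,
          \<chi> j. of_real (k $ j) - (of_real (S $ j) - \<i> * of_real (\<sigma>k\<^sup>2 * T $ j)) / 2)))"

definition smoothed_matrix_op ::
  "real \<Rightarrow> real \<Rightarrow> (('n::finite phase \<Rightarrow> complex) \<Rightarrow> complex)^'d::finite^'d \<Rightarrow>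
   ('n phase \<Rightarrow> complex^'d^'d) \<Rightarrow> 'n phase \<Rightarrow> complex^'d^'d" where
  "smoothed_matrix_op \<sigma>x \<sigma>k L W p =
     (\<chi> i j. \<Sum>l\<in>UNIV. smoothed_op \<sigma>x \<sigma>k (L $ i $ l) (\<lambda>q. W q $ l $ j) p)"

definition adjoint_matrix :: "complex^'d::finite^'d \<Rightarrow> complex^'d^'d" where
  "adjoint_matrix A = (\<chi> i j. cnj (A $ j $ i))"

definition hermitian_part :: "complex^'d::finite^'d \<Rightarrow> complex^'d^'d" where
  "hermitian_part A = (1/2) *\<^sub>R (A + adjoint_matrix A)"

end

theory Submission
  imports Defs "HOL-Probability.Probability" "HOL-Complex_Analysis.Conformal_Mappings"
begin

text \<open>
  Write \<open>W[f,g]\<close> for the smoothed Wigner transform. In the variables \<open>a = v + y/2\<close>,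
  \<open>b = v - y/2\<close> it is \<open>W[f,g](x,k) = \<integral> f(a) \<Phi>(a) da\<close>, where the window
  \<open>\<Phi>(a) = \<integral> kern(a,b) c cnj(g(b)) db\<close> is a Gaussian integral of \<open>g\<close> that depends on the phase
  point \<open>(x,k)\<close> and is a Schwartz function of \<open>a\<close> (\<open>smear_schwartz\<close>). So \<open>W[\<cdot>,g](x,k)\<close> is the
  pairing with one fixed test function, and the whole argument rests on the identity
  \<open>smoothed_op L W[f,g] (x,k) = weyl_op L f \<Phi>\<close> (\<open>smoothed_op_smoothed_wigner\<close>).

  Both sides of the identity are the functional \<open>L\<close> applied to a function on phase space, and these
  two functions are equal. Indeed, \<open>W[f,g]\<close> extends to the entire function obtained by inserting
  complex \<open>x, k\<close> into the Gaussian kernel, which is the only entire extension (\<open>entire_eqI\<close>). The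
  complex shift in the definition of the smoothed operator and its exponential prefactor complete the
  squares in the exponent of the Gaussian: the result is the kernel with \<open>a\<close> replaced by \<open>a - T\<close>,
  times the oscillation \<open>exp(2\<pi>i S(a - T/2))\<close> (\<open>phase_shift_identity\<close>). Hence the function under the Fourier transform is
  \<open>\<integral> exp(2\<pi>i S X) f(X + T/2) \<Phi>(X - T/2) dX\<close>, the ambiguity function of \<open>f\<close> and \<open>\<Phi>\<close>. Its Fourier
  transform in \<open>S\<close> is undone by Fourier inversion, and what remains is the integral over \<open>T = -z\<close> in
  the definition of the Weyl operator (\<open>fourier_ambiguity\<close>). Fubini is legitimate there because the
  ambiguity function of Schwartz functions decays rapidly in \<open>S\<close> and \<open>T\<close> (\<open>ambiguity_decay\<close>).

  For the theorem, the equation \<open>u\<^sub>t + L u = 0\<close>, now with a matrix \<open>L\<close>, tested with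
  the windows of the components of \<open>u\<close> gives
  \<open>W[(u\<^sub>t)\<^sub>i, u\<^sub>j] = - (\<Lambda>W)\<^sub>i\<^sub>j\<close>, where \<open>\<Lambda>\<close> is the matrix of smoothed operators. The product rule
  for the sesquilinear \<open>W\<close> (\<open>smoothed_wigner_has_vector_derivative\<close>) and the symmetry
  \<open>W[g,f] = cnj W[f,g]\<close> turn this into \<open>- (\<Lambda>W + (\<Lambda>W)\<^sup>*)\<close> for the time derivative.
\<close>

unbundle no fps_syntax

section \<open>Integrals over Euclidean spaces\<close>

text \<open>Along every sequence that tends to \<open>p0\<close> the remainders of the difference quotients of the integrand are
dominated by \<open>2 B\<close>, by the mean value inequality, so dominated convergence applies.
The bounds are asked for on the unit ball around \<open>p0\<close> only, so that \<open>B\<close> may depend on \<open>p0\<close>.\<close>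

lemma has_derivative_integral_dominated:
  fixes q :: "'p::real_normed_vector \<Rightarrow> 'b \<Rightarrow> 'c::{banach,second_countable_topology}"
  assumes meas: "\<And>p. q p \<in> borel_measurable M"
    and measD: "\<And>h. (\<lambda>b. D p0 b h) \<in> borel_measurable M"
    and int0: "integrable M (q p0)"
    and intB: "integrable M B"
    and B0: "\<And>b. 0 \<le> B b"
    and der: "\<And>p b. p \<in> ball p0 1 \<Longrightarrow> ((\<lambda>p. q p b) has_derivative D p b) (at p)"
    and bnd: "\<And>p b h. p \<in> ball p0 1 \<Longrightarrow> norm (D p b h) \<le> B b * norm h"
  shows "((\<lambda>p. \<integral>b. q p b \<partial>M) has_derivative (\<lambda>h. \<integral>b. D p0 b h \<partial>M)) (at p0)"
proof -
  have p0: "p0 \<in> ball p0 1" by simp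
  have intD: "integrable M (\<lambda>b. D p0 b h)" for h
    by (rule Bochner_Integration.integrable_bound[where f="\<lambda>b. B b * norm h"])
       (use intB measD bnd[OF p0] in \<open>auto intro!: AE_I2 order.trans[OF bnd[OF p0] abs_ge_self]\<close>)
  have lip: "norm (q (p0 + h) b - q p0 b) \<le> B b * norm h" if "norm h < 1" for h b
  proof -
    have "norm (q (p0 + h) b - q p0 b) \<le> B b * norm (p0 + h - p0)"
    proof (rule differentiable_bound[where S="ball p0 1" and f'="\<lambda>p. D p b"])
      show "((\<lambda>p. q p b) has_derivative D p b) (at p within ball p0 1)" if "p \<in> ball p0 1" for p
        using der[OF that] by (rule has_derivative_at_withinI)
      show "onorm (D p b) \<le> B b" if "p \<in> ball p0 1" for p
        using bnd[OF that, of b] B0[of b] by (intro onorm_bound)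
    qed (use that in \<open>auto simp: dist_norm\<close>)
    then show ?thesis by simp
  qed
  have intq: "integrable M (q (p0 + h))" if "norm h < 1" for h
  proof -
    have "integrable M (\<lambda>b. q (p0 + h) b - q p0 b)"
      by (rule Bochner_Integration.integrable_bound[where f="\<lambda>b. B b * norm h"])
         (use intB meas lip[OF that] in \<open>auto intro!: AE_I2 order.trans[OF lip[OF that] abs_ge_self]\<close>)
    from Bochner_Integration.integrable_add[OF this int0] show ?thesis by simp
  qed
  have lin: "bounded_linear (\<lambda>h. \<integral>b. D p0 b h \<partial>M)"
  proof (rule bounded_linear_intro[where K="integral\<^sup>L M B"])
    have bl: "bounded_linear (D p0 b)" for b
      using der[OF p0] by (rule has_derivative_bounded_linear)
    show "(\<integral>b. D p0 b (h + k) \<partial>M) = (\<integral>b. D p0 b h \<partial>M) + (\<integral>b. D p0 b k \<partial>M)" for h k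
      by (subst Bochner_Integration.integral_add[symmetric])
         (auto simp: intD linear_add[OF bounded_linear.linear[OF bl]])
    show "(\<integral>b. D p0 b (r *\<^sub>R h) \<partial>M) = r *\<^sub>R (\<integral>b. D p0 b h \<partial>M)" for r h
      by (subst integral_scaleR_right[symmetric])
         (auto simp: intD linear_scale[OF bounded_linear.linear[OF bl]])
    show "norm (\<integral>b. D p0 b h \<partial>M) \<le> norm h * integral\<^sup>L M B" for h
    proof -
      have "norm (\<integral>b. D p0 b h \<partial>M) \<le> (\<integral>b. B b * norm h \<partial>M)"
        by (rule order.trans[OF integral_norm_bound integral_mono])
           (use intD intB bnd[OF p0] in auto)
      then show ?thesis by (simp add: mult.commute)
    qed
  qed
  have lim: "(\<lambda>n. norm ((\<integral>b. q (p0 + X n) b \<partial>M) - (\<integral>b. q p0 b \<partial>M) - (\<integral>b. D p0 b (X n) \<partial>M)) / norm (X n))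
      \<longlonglongrightarrow> 0"
    if X: "\<And>n. X n \<noteq> 0" "X \<longlonglongrightarrow> 0" "\<And>n. norm (X n) < 1" for X
  proof -
    let ?r = "\<lambda>n b. (q (p0 + X n) b - q p0 b - D p0 b (X n)) /\<^sub>R norm (X n)"
    have "(\<lambda>n. \<integral>b. ?r n b \<partial>M) \<longlonglongrightarrow> (\<integral>b. 0 \<partial>M)"
    proof (rule integral_dominated_convergence[where w="\<lambda>b. 2 * B b"])
      show "AE b in M. (\<lambda>n. ?r n b) \<longlonglongrightarrow> 0"
      proof (rule AE_I2)
        fix b
        have "((\<lambda>h. norm (q (p0 + h) b - q p0 b - D p0 b h) / norm h) \<longlongrightarrow> 0) (at 0)"
          using der[OF p0, of b] by (simp add: has_derivative_at)
        moreover have "filterlim X (at 0) sequentially"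
          using X by (simp add: filterlim_at)
        ultimately have "(\<lambda>n. norm (q (p0 + X n) b - q p0 b - D p0 b (X n)) / norm (X n)) \<longlonglongrightarrow> 0"
          by (rule filterlim_compose)
        then have "(\<lambda>n. norm (?r n b)) \<longlonglongrightarrow> 0" by (simp add: divide_inverse mult.commute)
        then show "(\<lambda>n. ?r n b) \<longlonglongrightarrow> 0" by (rule tendsto_norm_zero_cancel)
      qed
      show "AE b in M. norm (?r n b) \<le> 2 * B b" for n
      proof (rule AE_I2)
        fix b
        have "norm (q (p0 + X n) b - q p0 b - D p0 b (X n)) \<le> B b * norm (X n) + B b * norm (X n)"
          by (rule order.trans[OF norm_triangle_ineq4 add_mono[OF lip[OF X(3)] bnd[OF p0]]])
        then show "norm (?r n b) \<le> 2 * B b"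
          using X(1)[of n] unfolding norm_scaleR by (simp add: inverse_eq_divide divide_le_eq)
      qed
    qed (use meas measD intB in auto)
    then have "(\<lambda>n. \<integral>b. ?r n b \<partial>M) \<longlonglongrightarrow> 0" by simp
    moreover have "(\<integral>b. ?r n b \<partial>M) =
        ((\<integral>b. q (p0 + X n) b \<partial>M) - (\<integral>b. q p0 b \<partial>M) - (\<integral>b. D p0 b (X n) \<partial>M)) /\<^sub>R norm (X n)" for n
      using intq[OF X(3)] int0 intD by simp
    ultimately have "(\<lambda>n. ((\<integral>b. q (p0 + X n) b \<partial>M) - (\<integral>b. q p0 b \<partial>M) - (\<integral>b. D p0 b (X n) \<partial>M))
        /\<^sub>R norm (X n)) \<longlonglongrightarrow> 0" by (simp only:)
    from tendsto_norm[OF this] show ?thesis by (simp add: divide_inverse mult.commute)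
  qed
  show ?thesis
    unfolding has_derivative_at
  proof (intro conjI lin, unfold tendsto_at_iff_sequentially comp_def, intro allI impI)
    fix X :: "nat \<Rightarrow> 'p" assume X: "\<forall>i. X i \<in> UNIV - {0}" "X \<longlonglongrightarrow> 0"
    from X(2) have "\<forall>\<^sub>F n in sequentially. norm (X n) < 1"
      by (auto simp: tendsto_iff dist_norm)
    then obtain N where N: "\<And>n. n \<ge> N \<Longrightarrow> norm (X n) < 1" by (auto simp: eventually_sequentially)
    show "(\<lambda>n. norm ((\<integral>b. q (p0 + X n) b \<partial>M) - (\<integral>b. q p0 b \<partial>M) - (\<integral>b. D p0 b (X n) \<partial>M)) / norm (X n))
      \<longlonglongrightarrow> 0"
      by (rule LIMSEQ_offset[where k=N], rule lim) (use X N in \<open>auto simp: LIMSEQ_ignore_initial_segment\<close>)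
  qed
qed

lemma integral_lborel_affine:
  fixes f :: "'a::euclidean_space \<Rightarrow> 'b::{banach,second_countable_topology}"
  assumes c: "c \<noteq> 0" and [measurable]: "f \<in> borel_measurable borel"
  shows "integrable lborel (\<lambda>x. f (t + c *\<^sub>R x)) \<longleftrightarrow> integrable lborel f"
    and "(\<integral>x. f (t + c *\<^sub>R x) \<partial>lborel) = (\<integral>x. f x \<partial>lborel) /\<^sub>R \<bar>c\<bar> ^ DIM('a)"
proof -
  let ?d = "\<bar>c\<bar> ^ DIM('a)"
  have d: "?d > 0" using c by simp
  have "integrable lborel f \<longleftrightarrow>
      integrable (density (distr lborel borel (\<lambda>x. t + c *\<^sub>R x)) (\<lambda>_. ?d)) f"
    by (subst lborel_affine[OF c, of t]) (simp add: ennreal_power)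
  also have "\<dots> \<longleftrightarrow> integrable lborel (\<lambda>x. ?d *\<^sub>R f (t + c *\<^sub>R x))"
    using d by (subst integrable_density) (auto simp: integrable_distr_eq)
  also have "\<dots> \<longleftrightarrow> integrable lborel (\<lambda>x. f (t + c *\<^sub>R x))"
    using d integrable_scaleR_right[of "inverse ?d" lborel "\<lambda>x. ?d *\<^sub>R f (t + c *\<^sub>R x)"]
    by auto
  finally show "integrable lborel (\<lambda>x. f (t + c *\<^sub>R x)) \<longleftrightarrow> integrable lborel f" ..
  have "(\<integral>x. f x \<partial>lborel) =
      (\<integral>x. f x \<partial>density (distr lborel borel (\<lambda>x. t + c *\<^sub>R x)) (\<lambda>_. ?d))"
    by (subst lborel_affine[OF c, of t]) (simp add: ennreal_power)
  also have "\<dots> = ?d *\<^sub>R (\<integral>x. f (t + c *\<^sub>R x) \<partial>lborel)"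
    using d by (subst integral_density) (auto simp: integral_distr)
  finally show "(\<integral>x. f (t + c *\<^sub>R x) \<partial>lborel) = (\<integral>x. f x \<partial>lborel) /\<^sub>R ?d"
    using d by simp
qed

lemma integrable_pair_mult:
  fixes f :: "'a::euclidean_space \<Rightarrow> 'c::{real_normed_field,banach,second_countable_topology}"
    and g :: "'b::euclidean_space \<Rightarrow> 'c"
  assumes f: "integrable lborel f" and g: "integrable lborel g"
  shows "integrable lborel (\<lambda>(x, y). f x * g y)"
proof -
  have [measurable]: "f \<in> borel_measurable borel" "g \<in> borel_measurable borel"
    using borel_measurable_integrable[OF f] borel_measurable_integrable[OF g] by simp_all
  have "integrable (lborel \<Otimes>\<^sub>M lborel) (\<lambda>(x, y). f x * g y)"
    by (rule lborel_pair.Fubini_integrable) (use f g in \<open>auto simp: norm_mult\<close>)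
  then show ?thesis by (simp add: lborel_prod)
qed

lemma integral_lborel_prod_coords:
  fixes f :: "'a::euclidean_space \<Rightarrow> real \<Rightarrow> 'c::{real_normed_field,banach,second_countable_topology}"
  assumes f: "\<And>b. b \<in> Basis \<Longrightarrow> integrable lborel (f b)"
  shows "integrable lborel (\<lambda>x::'a. \<Prod>b\<in>Basis. f b (x \<bullet> b))"
    and "(\<integral>x. (\<Prod>b\<in>Basis. f b (x \<bullet> b)) \<partial>lborel) = (\<Prod>b\<in>Basis. \<integral>s. f b s \<partial>lborel)"
proof -
  interpret product_sigma_finite "\<lambda>_::'a. lborel :: real measure" ..
  have [measurable]: "f b \<in> borel_measurable borel" if "b \<in> Basis" for b
    using borel_measurable_integrable[OF f[OF that]] by simp
  have eq: "(\<Prod>b\<in>Basis. f b ((\<Sum>i\<in>Basis. y i *\<^sub>R i) \<bullet> b)) = (\<Prod>b\<in>Basis. f b (y b))" for y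
    by (intro prod.cong refl) (simp add: inner_sum_left inner_Basis if_distrib cong: if_cong)
  show "integrable lborel (\<lambda>x::'a. \<Prod>b\<in>Basis. f b (x \<bullet> b))"
    by (subst lborel_eq, subst integrable_distr_eq)
       (auto simp: eq intro!: product_integrable_prod f borel_measurable_prod)
  have "(\<integral>x. (\<Prod>b\<in>Basis. f b (x \<bullet> b)) \<partial>lborel) =
      (\<integral>y. (\<Prod>b\<in>Basis. f b (y b)) \<partial>(\<Pi>\<^sub>M b\<in>Basis. lborel))"
    by (subst lborel_eq, subst integral_distr) (auto simp: eq intro!: borel_measurable_prod)
  also have "\<dots> = (\<Prod>b\<in>Basis. \<integral>s. f b s \<partial>lborel)"
    by (rule product_integral_prod) (auto intro: f)
  finally show "(\<integral>x. (\<Prod>b\<in>Basis. f b (x \<bullet> b)) \<partial>lborel) = (\<Prod>b\<in>Basis. \<integral>s. f b s \<partial>lborel)" .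
qed

text \<open>Comparison with a product over the coordinates: \<open>(1 + \<bar>x\<bar>)\<^sup>2\<close> bounds each \<open>1 + x\<^sub>b\<^sup>2\<close>, and
\<open>1 / (1 + t\<^sup>2)\<close> is integrable on the line. This power is the reference weight in the
integrability estimates below.\<close>

lemma integrable_inverse_power_norm:
  "integrable lborel (\<lambda>x::'a::euclidean_space. 1 / (1 + norm x) ^ (2 * DIM('a)))"
proof -
  have "integrable lborel (\<lambda>x::real. inverse (1 + x\<^sup>2))"
    using integrable_inverse_1_plus_square by (simp add: set_integrable_def)
  then have int: "integrable lborel (\<lambda>x::'a. \<Prod>b\<in>Basis. inverse (1 + (x \<bullet> b)\<^sup>2))"
    by (rule integral_lborel_prod_coords)
  show ?thesis
  proof (rule Bochner_Integration.integrable_bound[OF int])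
    show "AE x::'a in lborel. norm (1 / (1 + norm x) ^ (2 * DIM('a)))
        \<le> norm (\<Prod>b\<in>Basis. inverse (1 + (x \<bullet> b)\<^sup>2))"
    proof (rule AE_I2)
      fix x :: 'a
      have "1 + (x \<bullet> b)\<^sup>2 \<le> (1 + norm x)\<^sup>2" if "b \<in> Basis" for b
      proof -
        have "(x \<bullet> b)\<^sup>2 \<le> (norm x)\<^sup>2"
          using Basis_le_norm[OF that, of x] by (simp add: power2_le_iff_abs_le)
        then show ?thesis by (simp add: power2_sum add_increasing2)
      qed
      then have "(\<Prod>b\<in>(Basis::'a set). inverse ((1 + norm x)\<^sup>2)) \<le> (\<Prod>b\<in>(Basis::'a set). inverse (1 + (x \<bullet> b)\<^sup>2))"
        by (intro prod_mono) (auto intro!: le_imp_inverse_le add_pos_nonneg)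
      moreover have "(\<Prod>b\<in>(Basis::'a set). inverse ((1 + norm x)\<^sup>2)) = 1 / (1 + norm x) ^ (2 * DIM('a))"
        by (simp add: power_mult power_inverse inverse_eq_divide power_one_over)
      ultimately show "norm (1 / (1 + norm x) ^ (2 * DIM('a)))
          \<le> norm (\<Prod>b\<in>Basis. inverse (1 + (x \<bullet> b)\<^sup>2))"
        by (simp add: prod_nonneg)
    qed
  qed simp
qed

section \<open>Fourier inversion\<close>

text \<open>This is the characteristic function of the standard normal distribution, rescaled by \<open>sqrt (2\<pi>)\<close>
so that the Gaussian is its own Fourier transform.\<close>

lemma gaussian_fourier_real:
  fixes w :: real
  shows "integrable lborel (\<lambda>s::real. exp (2 * of_real pi * \<i> * of_real (s * w)) * of_real (exp (- pi * s\<^sup>2)))"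
  and "(\<integral>s. exp (2 * of_real pi * \<i> * of_real (s * w)) * of_real (exp (- pi * s\<^sup>2)) \<partial>lborel) =
    complex_of_real (exp (- pi * w\<^sup>2))"
proof -
  define c where "c = sqrt (2 * pi)"
  have c: "c > 0" "c\<^sup>2 = 2 * pi" by (simp_all add: c_def)
  let ?F = "\<lambda>y::real. std_normal_density y *\<^sub>R iexp (c * w * y)"
  have intF: "integrable lborel ?F"
    by (rule Bochner_Integration.integrable_bound[OF integrable_normal_density[of 1 0]])
       (auto simp: std_normal_density_def)
  have "(\<integral>y. ?F y \<partial>lborel) = char std_normal_distribution (c * w)"
    unfolding char_def by (subst integral_density) (auto simp: std_normal_density_def)
  also have "\<dots> = exp (- pi * w\<^sup>2)"
    by (simp add: char_std_normal_distribution power_mult_distrib c)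
  finally have F: "(\<integral>y. ?F y \<partial>lborel) = exp (- pi * w\<^sup>2)" .
  have eq: "exp (2 * of_real pi * \<i> * of_real (s * w)) * of_real (exp (- pi * s\<^sup>2)) = c *\<^sub>R ?F (0 + c *\<^sub>R s)" for s
  proof -
    have "c * (c * X) = 2 * pi * X" for X using c by (simp add: power2_eq_square)
    then have e: "c * w * (c * s) = 2 * pi * (s * w)" by (simp add: ac_simps)
    have "c * std_normal_density (c * s) = exp (- pi * s\<^sup>2)"
      using c(1) by (simp add: std_normal_density_def c_def[symmetric] power_mult_distrib c(2))
    then have "c *\<^sub>R ?F (0 + c *\<^sub>R s) = exp (- pi * s\<^sup>2) *\<^sub>R iexp (2 * pi * (s * w))"
      by (simp only: scaleR_scaleR add_0 real_scaleR_def e)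
    then show ?thesis by (simp add: scaleR_conv_of_real ac_simps)
  qed
  have "integrable lborel (\<lambda>s. ?F (0 + c *\<^sub>R s))"
    by (subst integral_lborel_affine(1)) (use c intF in auto)
  then show "integrable lborel (\<lambda>s::real. exp (2 * of_real pi * \<i> * of_real (s * w)) * of_real (exp (- pi * s\<^sup>2)))"
    unfolding eq by (rule integrable_scaleR_right)
  have "(\<integral>s. ?F (0 + c *\<^sub>R s) \<partial>lborel) = (\<integral>y. ?F y \<partial>lborel) /\<^sub>R \<bar>c\<bar> ^ DIM(real)"
    by (rule integral_lborel_affine(2)) (use c in auto)
  then show "(\<integral>s. exp (2 * of_real pi * \<i> * of_real (s * w)) * of_real (exp (- pi * s\<^sup>2)) \<partial>lborel) =
    complex_of_real (exp (- pi * w\<^sup>2))"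
    unfolding eq integral_scaleR_right using c F by simp
qed

lemma exp_norm_squared_prod:
  fixes x :: "'a::euclidean_space"
  shows "exp (- pi * (norm x)\<^sup>2) = (\<Prod>b\<in>Basis. exp (- pi * (x \<bullet> b)\<^sup>2))"
proof -
  have "(norm x)\<^sup>2 = (\<Sum>b\<in>Basis. (x \<bullet> b)\<^sup>2)"
    unfolding power2_norm_eq_inner by (subst euclidean_inner) (simp add: power2_eq_square)
  then show ?thesis by (simp add: exp_sum sum_distrib_left)
qed

lemma gaussian_fourier:
  fixes w :: "'a::euclidean_space"
  shows "integrable lborel (\<lambda>x::'a. exp (2 * of_real pi * \<i> * of_real (x \<bullet> w)) * of_real (exp (- pi * (norm x)\<^sup>2)))"
  and "(\<integral>x. exp (2 * of_real pi * \<i> * of_real (x \<bullet> w)) * of_real (exp (- pi * (norm x)\<^sup>2)) \<partial>lborel) =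
    complex_of_real (exp (- pi * (norm w)\<^sup>2))"
proof -
  have eq: "exp (2 * of_real pi * \<i> * of_real (x \<bullet> w)) * of_real (exp (- pi * (norm x)\<^sup>2)) =
     (\<Prod>b\<in>Basis. exp (2 * of_real pi * \<i> * of_real ((x \<bullet> b) * (w \<bullet> b))) *
        complex_of_real (exp (- pi * (x \<bullet> b)\<^sup>2)))" for x :: 'a
    unfolding exp_norm_squared_prod prod.distrib of_real_prod
    by (simp add: euclidean_inner[of x w] sum_distrib_left exp_sum)
  show "integrable lborel (\<lambda>x::'a. exp (2 * of_real pi * \<i> * of_real (x \<bullet> w)) * of_real (exp (- pi * (norm x)\<^sup>2)))"
    unfolding eq by (rule integral_lborel_prod_coords(1)) (rule gaussian_fourier_real(1))
  show "(\<integral>x. exp (2 * of_real pi * \<i> * of_real (x \<bullet> w)) * of_real (exp (- pi * (norm x)\<^sup>2)) \<partial>lborel) =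
    complex_of_real (exp (- pi * (norm w)\<^sup>2))"
    unfolding eq 
    by (subst integral_lborel_prod_coords(2)[OF gaussian_fourier_real(1)])
       (simp only: gaussian_fourier_real(2) exp_norm_squared_prod of_real_prod)
qed

text \<open>Gaussian regularisation: with the extra factor \<open>exp(-\<pi>\<epsilon>\<^sup>2\<bar>s\<bar>\<^sup>2)\<close> Fubini applies, and the inner integral
is a Gaussian approximate identity of width \<open>\<epsilon>\<close> in the variable of \<open>h\<close>. Dominated convergence
as \<open>\<epsilon>\<close> tends to 0 works on both sides, by integrability of \<open>G\<close> on the one and boundedness and continuity
of \<open>h\<close> on the other.\<close>

lemma fourier_inversion:
  fixes h :: "'a::euclidean_space \<Rightarrow> complex"
  assumes cont: "continuous_on UNIV h" and bd: "\<And>x. norm (h x) \<le> K" and int: "integrable lborel h"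
  defines "G \<equiv> (\<lambda>s. \<integral>x. exp (2 * of_real pi * \<i> * of_real (s \<bullet> x)) * h x \<partial>lborel)"
  assumes intG: "integrable lborel G"
  shows "(\<integral>s. exp (- 2 * of_real pi * \<i> * of_real (s \<bullet> x)) * G s \<partial>lborel) = h x"
proof -
  let ?e = "\<lambda>y. exp (2 * of_real pi * \<i> * complex_of_real y)"
  let ?g = "\<lambda>s::'a. complex_of_real (exp (- pi * (norm s)\<^sup>2))"
  have ne: "norm (?e y) = 1" for y by (simp add: norm_exp_eq_Re)
  have e_add: "?e (y + z) = ?e y * ?e z" for y z by (simp add: exp_add distrib_left)
  have [measurable]: "h \<in> borel_measurable borel"
    using cont by (rule borel_measurable_continuous_onI)
  have intg: "integrable lborel ?g" and g1: "(\<integral>s. ?g s \<partial>lborel) = 1"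
    using gaussian_fourier[of 0] by simp_all
  have [measurable]: "G \<in> borel_measurable borel" using borel_measurable_integrable[OF intG] by simp
  have step: "(\<integral>s. ?e (- (s \<bullet> x)) * G s * ?g (\<epsilon> *\<^sub>R s) \<partial>lborel) = (\<integral>y. h (x + \<epsilon> *\<^sub>R y) * ?g y \<partial>lborel)"
    if \<epsilon>: "\<epsilon> > 0" for \<epsilon> :: real
  proof -
    let ?F = "\<lambda>s z. ?e (s \<bullet> (z - x)) * ?g (\<epsilon> *\<^sub>R s) * h z"
    have intge: "integrable lborel (\<lambda>s. ?g (0 + \<epsilon> *\<^sub>R s))"
      by (subst integral_lborel_affine(1)) (use \<epsilon> intg in auto)
    have F: "integrable (lborel \<Otimes>\<^sub>M lborel) (\<lambda>(s, z). ?F s z)"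
    proof (rule Bochner_Integration.integrable_bound)
      show "integrable (lborel \<Otimes>\<^sub>M lborel) (\<lambda>(s, z). ?g (0 + \<epsilon> *\<^sub>R s) * h z)"
        unfolding lborel_prod by (rule integrable_pair_mult[OF intge int])
    qed (auto simp: norm_mult ne)
    have "(\<integral>s. ?e (- (s \<bullet> x)) * G s * ?g (\<epsilon> *\<^sub>R s) \<partial>lborel) = (\<integral>s. (\<integral>z. ?F s z \<partial>lborel) \<partial>lborel)"
    proof (intro Bochner_Integration.integral_cong refl)
      fix s
      have "?F s z = (?e (- (s \<bullet> x)) * ?g (\<epsilon> *\<^sub>R s)) * (?e (s \<bullet> z) * h z)" for z
      proof -
        have "?e (s \<bullet> (z - x)) = ?e (s \<bullet> z) * ?e (- (s \<bullet> x))"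
          unfolding e_add[symmetric] by (simp add: inner_diff_right)
        then show ?thesis by (simp only: mult_ac)
      qed
      then have "(\<integral>z. ?F s z \<partial>lborel) = (?e (- (s \<bullet> x)) * ?g (\<epsilon> *\<^sub>R s)) * G s"
        unfolding G_def by (simp only: integral_mult_right_zero)
      then show "?e (- (s \<bullet> x)) * G s * ?g (\<epsilon> *\<^sub>R s) = (\<integral>z. ?F s z \<partial>lborel)"
        by (simp only: mult_ac)
    qed
    also have "\<dots> = (\<integral>z. (\<integral>s. ?F s z \<partial>lborel) \<partial>lborel)"
      using lborel_pair.Fubini_integral[OF F] by simp
    also have "\<dots> = (\<integral>z. (?g ((z - x) /\<^sub>R \<epsilon>) * h z) /\<^sub>R \<epsilon> ^ DIM('a) \<partial>lborel)"
    proof (intro Bochner_Integration.integral_cong refl)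
      fix z
      have "s \<bullet> (z - x) = (0 + \<epsilon> *\<^sub>R s) \<bullet> ((z - x) /\<^sub>R \<epsilon>)" for s
        using \<epsilon> by simp
      then have "(\<integral>s. ?F s z \<partial>lborel) = (\<integral>s. ?e ((0 + \<epsilon> *\<^sub>R s) \<bullet> ((z - x) /\<^sub>R \<epsilon>)) * ?g (0 + \<epsilon> *\<^sub>R s) \<partial>lborel) * h z"
        by (simp only: add_0 integral_mult_left_zero)
      also have "(\<integral>s. ?e ((0 + \<epsilon> *\<^sub>R s) \<bullet> ((z - x) /\<^sub>R \<epsilon>)) * ?g (0 + \<epsilon> *\<^sub>R s) \<partial>lborel)
           = ?g ((z - x) /\<^sub>R \<epsilon>) /\<^sub>R \<epsilon> ^ DIM('a)"
        using \<epsilon> by (subst integral_lborel_affine(2)[where f="\<lambda>s. ?e (s \<bullet> ((z - x) /\<^sub>R \<epsilon>)) * ?g s"])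
          (simp, measurable, simp only: gaussian_fourier(2) abs_of_pos)
      finally show "(\<integral>s. ?F s z \<partial>lborel) = (?g ((z - x) /\<^sub>R \<epsilon>) * h z) /\<^sub>R \<epsilon> ^ DIM('a)" by simp
    qed
    also have "\<dots> = (\<integral>z. ?g ((z - x) /\<^sub>R \<epsilon>) * h z \<partial>lborel) /\<^sub>R \<epsilon> ^ DIM('a)" by simp
    also have "\<dots> = (\<integral>y. ?g (((x + \<epsilon> *\<^sub>R y) - x) /\<^sub>R \<epsilon>) * h (x + \<epsilon> *\<^sub>R y) \<partial>lborel)"
      by (subst integral_lborel_affine(2)[where f="\<lambda>z. ?g ((z - x) /\<^sub>R \<epsilon>) * h z"]) (use \<epsilon> in auto)
    finally show ?thesis using \<epsilon> by (simp add: mult.commute)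
  qed
  have E: "(\<lambda>n. inverse (real (Suc n))) \<longlonglongrightarrow> 0" by (rule LIMSEQ_inverse_real_of_nat)
  have "(\<lambda>n. \<integral>s. ?e (- (s \<bullet> x)) * G s * ?g (inverse (real (Suc n)) *\<^sub>R s) \<partial>lborel) \<longlonglongrightarrow>
      (\<integral>s. ?e (- (s \<bullet> x)) * G s * ?g (0 *\<^sub>R s) \<partial>lborel)"
  proof (rule integral_dominated_convergence[where w="\<lambda>s. norm (G s)"])
    show "AE s in lborel. (\<lambda>n. ?e (- (s \<bullet> x)) * G s * ?g (inverse (real (Suc n)) *\<^sub>R s))
        \<longlonglongrightarrow> ?e (- (s \<bullet> x)) * G s * ?g (0 *\<^sub>R s)"
      by (intro AE_I2 tendsto_intros E)
  qed (use intG in \<open>auto simp: norm_mult ne mult_left_le\<close>)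
  moreover have "(\<lambda>n. \<integral>y. h (x + inverse (real (Suc n)) *\<^sub>R y) * ?g y \<partial>lborel) \<longlonglongrightarrow>
      (\<integral>y. h (x + 0 *\<^sub>R y) * ?g y \<partial>lborel)"
  proof (rule integral_dominated_convergence[where w="\<lambda>s. K * norm (?g s)"])
    show "AE y in lborel. (\<lambda>n. h (x + inverse (real (Suc n)) *\<^sub>R y) * ?g y)
        \<longlonglongrightarrow> h (x + 0 *\<^sub>R y) * ?g y"
    proof (intro AE_I2 tendsto_mult tendsto_const)
      fix y
      show "(\<lambda>n. h (x + inverse (real (Suc n)) *\<^sub>R y)) \<longlonglongrightarrow> h (x + 0 *\<^sub>R y)"
        by (rule continuous_on_tendsto_compose[OF cont]) (intro tendsto_intros E, auto)
    qed
    show "AE y in lborel. norm (h (x + inverse (real (Suc n)) *\<^sub>R y) * ?g y) \<le> K * norm (?g y)" for n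
      by (intro AE_I2) (simp add: norm_mult bd)
    show "integrable lborel (\<lambda>s. K * norm (?g s))"
      by (intro integrable_mult_right integrable_norm intg)
  qed auto
  ultimately have "(\<integral>s. ?e (- (s \<bullet> x)) * G s * ?g (0 *\<^sub>R s) \<partial>lborel) = (\<integral>y. h (x + 0 *\<^sub>R y) * ?g y \<partial>lborel)"
    by (subst (asm) step) (auto intro: LIMSEQ_unique)
  then show ?thesis using g1 by simp
qed

section \<open>Rapidly decaying functions and Schwartz functions\<close>

text \<open>Rapid decay without smoothness. It suffices for everything that is smoothed by a Gaussian and,
unlike membership in the Schwartz space, needs no work on derivatives.\<close>

definition rapid :: "('a::euclidean_space \<Rightarrow> complex) \<Rightarrow> bool" where
  "rapid f \<longleftrightarrow> f \<in> borel_measurable borel \<and> (\<forall>m. \<exists>C. \<forall>x. (1 + norm x) ^ m * norm (f x) \<le> C)"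

lemma rapid_measurable [measurable_dest]: "rapid f \<Longrightarrow> f \<in> borel_measurable borel"
  by (simp add: rapid_def)

lemma rapid_boundE:
  assumes "rapid f"
  obtains C where "C > 0" "\<And>x. norm (f x) \<le> C / (1 + norm x) ^ m"
proof -
  obtain C where C: "\<And>x. (1 + norm x) ^ m * norm (f x) \<le> C"
    using assms by (auto simp: rapid_def)
  show ?thesis
  proof (rule that[of "max C 1"])
    show "norm (f x) \<le> max C 1 / (1 + norm x) ^ m" for x
      using C[of x] by (simp add: field_simps max.coboundedI1 add_pos_nonneg)
  qed simp
qed

lemma rapid_integrable_weighted:
  assumes "rapid (f :: 'a::euclidean_space \<Rightarrow> complex)"
  shows "integrable lborel (\<lambda>x. (1 + norm x) ^ m * norm (f x))"
proof -
  obtain C where C: "C > 0" "\<And>x. norm (f x) \<le> C / (1 + norm x) ^ (m + 2 * DIM('a))"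
    using rapid_boundE[OF assms] by blast
  note [measurable] = rapid_measurable[OF assms]
  show ?thesis
  proof (rule Bochner_Integration.integrable_bound)
    show "integrable lborel (\<lambda>x::'a. C * (1 / (1 + norm x) ^ (2 * DIM('a))))"
      by (intro integrable_mult_right integrable_inverse_power_norm)
    show "AE x in lborel. norm ((1 + norm x) ^ m * norm (f x)) \<le> norm (C * (1 / (1 + norm x) ^ (2 * DIM('a))))"
    proof (rule AE_I2)
      fix x :: 'a
      have "1 + norm x > 0" by (simp add: add_pos_nonneg)
      then show "norm ((1 + norm x) ^ m * norm (f x)) \<le> norm (C * (1 / (1 + norm x) ^ (2 * DIM('a))))"
        using C(1) C(2)[of x] by (simp add: field_simps power_add)
    qed
  qed simp
qed

lemma rapid_integrable:
  assumes "rapid f" shows "integrable lborel f"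
  by (rule Bochner_Integration.integrable_bound[OF rapid_integrable_weighted[OF assms, of 0]])
     (use rapid_measurable[OF assms] in auto)

lemma rapid_add:
  assumes "rapid f" "rapid g" shows "rapid (\<lambda>x. f x + g x)"
  unfolding rapid_def
proof (intro conjI allI)
  fix m
  obtain C D where *: "\<And>x. (1 + norm x) ^ m * norm (f x) \<le> C" "\<And>x. (1 + norm x) ^ m * norm (g x) \<le> D"
    using assms unfolding rapid_def by metis
  show "\<exists>C. \<forall>x. (1 + norm x) ^ m * norm (f x + g x) \<le> C"
  proof (intro exI allI)
    fix x
    have "(1 + norm x) ^ m * norm (f x + g x) \<le> (1 + norm x) ^ m * (norm (f x) + norm (g x))"
      by (intro mult_left_mono norm_triangle_ineq) auto
    also have "\<dots> \<le> C + D" using *[of x] by (simp add: distrib_left)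
    finally show "(1 + norm x) ^ m * norm (f x + g x) \<le> C + D" .
  qed
qed (use assms in \<open>auto simp: rapid_def intro: borel_measurable_add\<close>)

lemma rapid_mult_polynomial_growth:
  assumes "rapid f" "p \<in> borel_measurable borel" "\<And>x. norm (p x) \<le> K * (1 + norm x) ^ j"
  shows "rapid (\<lambda>x. p x * f x)"
  unfolding rapid_def
proof (intro conjI allI)
  fix m
  obtain C where *: "\<And>x. (1 + norm x) ^ (m + j) * norm (f x) \<le> C"
    using assms(1) unfolding rapid_def by metis
  have "norm (p 0) \<le> K" using assms(3)[of 0] by simp
  then have K: "K \<ge> 0" using norm_ge_zero order.trans by blast
  show "\<exists>C. \<forall>x. (1 + norm x) ^ m * norm (p x * f x) \<le> C"
  proof (intro exI allI)
    fix x
    have "(1 + norm x) ^ m * norm (p x * f x) \<le> (1 + norm x) ^ m * ((K * (1 + norm x) ^ j) * norm (f x))"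
      unfolding norm_mult by (intro mult_left_mono mult_right_mono assms(3)) auto
    also have "\<dots> = K * ((1 + norm x) ^ (m + j) * norm (f x))" by (simp add: power_add)
    also have "\<dots> \<le> K * C" by (intro mult_left_mono * K)
    finally show "(1 + norm x) ^ m * norm (p x * f x) \<le> K * C" .
  qed
qed (use assms in \<open>auto simp: rapid_def intro: borel_measurable_times\<close>)

lemma rapid_cmult: "rapid f \<Longrightarrow> rapid (\<lambda>x. c * f x)"
  by (rule rapid_mult_polynomial_growth[where K="norm c" and j=0]) auto

lemma rapid_inner_mult: "rapid f \<Longrightarrow> rapid (\<lambda>x. of_real (x \<bullet> v) * f x)"
proof (rule rapid_mult_polynomial_growth[where K="norm v" and j=1])
  show "norm (complex_of_real (x \<bullet> v)) \<le> norm v * (1 + norm x) ^ 1" for x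
    using Cauchy_Schwarz_ineq2[of x v] norm_ge_zero[of v] by (simp add: distrib_left mult.commute add_increasing)
qed auto

lemma rapid_cnj: "rapid f \<Longrightarrow> rapid (\<lambda>x. cnj (f x))"
  unfolding rapid_def by (auto intro: borel_measurable_continuous_on[OF continuous_on_cnj[OF continuous_on_id]])

lemma partials_append: "partials (vs @ ws) f = partials vs (partials ws f)"
  by (induction vs) auto

text \<open>A coinductive way to show that a function is Schwartz: it avoids a formula for the iterated
derivatives, since only a class that contains the first derivatives of its members has to be found.\<close>

lemma schwartz_closed_class:
  assumes "f \<in> \<C>"
    and "\<And>f x. f \<in> \<C> \<Longrightarrow> f differentiable (at x)"
    and "\<And>f v. f \<in> \<C> \<Longrightarrow> v \<in> Basis \<Longrightarrow> (\<lambda>x. frechet_derivative f (at x) v) \<in> \<C>"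
    and "\<And>f m. f \<in> \<C> \<Longrightarrow> \<exists>C. \<forall>x. (1 + norm x) ^ m * norm (f x) \<le> C"
  shows "schwartz f"
proof -
  have "partials vs f \<in> \<C>" if "set vs \<subseteq> Basis" for vs
    using that by (induction vs) (auto simp: assms)
  then show ?thesis
    using assms(2,4) by (fastforce simp: schwartz_def smooth_def bdd_above_def)
qed

lemma schwartz_differentiable: "schwartz f \<Longrightarrow> f differentiable (at x)"
  unfolding schwartz_def smooth_def by (metis empty_subsetI list.set(1) partials.simps(1))

lemma schwartz_has_derivative:
  "schwartz f \<Longrightarrow> (f has_derivative frechet_derivative f (at x)) (at x)"
  using schwartz_differentiable frechet_derivative_works by blast

lemma schwartz_continuous: "schwartz f \<Longrightarrow> continuous_on UNIV f"
  by (intro continuous_at_imp_continuous_on ballI differentiable_imp_continuous_within schwartz_differentiable)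

lemma schwartz_partial:
  assumes "schwartz f" "v \<in> Basis" shows "schwartz (\<lambda>x. frechet_derivative f (at x) v)"
proof -
  have "partials vs (\<lambda>x. frechet_derivative f (at x) v) = partials (vs @ [v]) f" for vs
    by (simp add: partials_append)
  then show ?thesis
    using assms by (auto simp: schwartz_def smooth_def)
qed

lemma schwartz_rapid: assumes "schwartz f" shows "rapid f"
  unfolding rapid_def
proof (intro conjI allI)
  show "f \<in> borel_measurable borel"
    using schwartz_continuous[OF assms] by (rule borel_measurable_continuous_onI)
  fix m
  have "bdd_above (range (\<lambda>x. (1 + norm x) ^ m * norm (partials [] f x)))"
    using assms empty_subsetI unfolding schwartz_def by (metis list.set(1))
  then show "\<exists>C. \<forall>x. (1 + norm x) ^ m * norm (f x) \<le> C" by (auto simp: bdd_above_def)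
qed

section \<open>Gaussian integrals of rapidly decaying functions are Schwartz functions\<close>

text \<open>From \<open>exp(y) \<ge> (1 + y/m)\<^sup>m\<close>: the constant \<open>K\<close> makes \<open>1 + t \<le> K (1 + \<alpha>t\<^sup>2/m)\<close>, and the \<open>m\<close>-th power
of this is at most \<open>K\<^sup>m exp(\<alpha>t\<^sup>2)\<close>.\<close>

lemma power_times_gaussian_bounded:
  assumes "\<alpha> > 0" obtains C where "\<And>t::real. t \<ge> 0 \<Longrightarrow> (1 + t) ^ m * exp (- \<alpha> * t\<^sup>2) \<le> C"
proof (cases "m = 0")
  case True
  then show ?thesis using assms that[of 1] by simp
next
  case False
  define K where "K = max 2 (m / \<alpha>)"
  have K: "K \<ge> 2" "K * (\<alpha> / m) \<ge> 1"
    using assms False by (auto simp: K_def field_simps max_def)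
  show ?thesis
  proof (rule that[of "K ^ m"])
    fix t :: real assume t: "t \<ge> 0"
    have "1 + t \<le> 2 + t\<^sup>2" using zero_le_power2[of "t - 1/2"] by (simp add: power2_diff) (simp add: power2_eq_square)
    also have "\<dots> \<le> K + (K * (\<alpha> / m)) * t\<^sup>2"
      using mult_right_mono[OF K(2), of "t\<^sup>2"] K(1) by simp
    also have "\<dots> = K * (1 + \<alpha> * t\<^sup>2 / m)" by (simp add: algebra_simps)
    finally have "(1 + t) ^ m \<le> (K * (1 + \<alpha> * t\<^sup>2 / m)) ^ m" using t by (intro power_mono) auto
    also have "\<dots> = K ^ m * (1 + \<alpha> * t\<^sup>2 / m) ^ m" by (rule power_mult_distrib)
    also have "\<dots> \<le> K ^ m * exp (\<alpha> * t\<^sup>2)"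
      using K(1) False assms
      by (intro mult_left_mono exp_ge_one_plus_x_over_n_power_n) (auto intro: order.trans[of _ 0])
    finally show "(1 + t) ^ m * exp (- \<alpha> * t\<^sup>2) \<le> K ^ m"
      by (simp add: exp_minus field_simps)
  qed
qed

lemma has_derivative_exp_comp:
  fixes E :: "'a::real_normed_vector \<Rightarrow> complex"
  assumes "(E has_derivative E') (at x)"
  shows "((\<lambda>x. exp (E x)) has_derivative (\<lambda>h. exp (E x) * E' h)) (at x)"
  using has_derivative_compose[OF assms, of exp "\<lambda>h. exp (E x) * h"] DERIV_exp[of "E x"]
  by (simp add: has_field_derivative_def mult_commute_abs)

text \<open>The Gaussian factor of the smoothed Wigner transform at the phase point \<open>(x, k)\<close>, in the variables
\<open>a\<close>, \<open>b\<close> with midpoint \<open>(a + b)/2\<close> and difference \<open>a - b\<close>. The transform with parameters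
\<open>\<sigma>x\<close>, \<open>\<sigma>k\<close> has \<open>\<alpha> = \<pi>\<sigma>k\<^sup>2/2\<close> and \<open>\<beta> = 2\<pi>/\<sigma>x\<^sup>2\<close>.\<close>

locale gaussian_kernel =
  fixes \<alpha> \<beta> :: real and x k :: "'a::euclidean_space"
  assumes \<alpha>: "\<alpha> > 0" and \<beta>: "\<beta> > 0"
begin

definition kern :: "'a \<Rightarrow> 'a \<Rightarrow> complex" where
  "kern a b = exp (- 2 * of_real pi * \<i> * of_real (k \<bullet> (a - b)) - of_real (\<alpha> * (norm (a - b))\<^sup>2)
      - of_real (\<beta> * (norm ((1/2) *\<^sub>R (a + b) - x))\<^sup>2))"

definition smear :: "('a \<Rightarrow> complex) \<Rightarrow> 'a \<Rightarrow> complex" where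
  "smear r a = (\<integral>b. kern a b * r b \<partial>lborel)"

lemma kern_measurable [measurable]: "(\<lambda>p. kern (fst p) (snd p)) \<in> borel_measurable borel"
  unfolding kern_def by (intro borel_measurable_continuous_onI continuous_intros)

lemma kern_measurable_snd [measurable]: "kern a \<in> borel_measurable borel"
  unfolding kern_def by (intro borel_measurable_continuous_onI continuous_intros)

lemma norm_kern: "norm (kern a b) = exp (- \<alpha> * (norm (a - b))\<^sup>2 - \<beta> * (norm ((1/2) *\<^sub>R (a + b) - x))\<^sup>2)"
  unfolding kern_def norm_exp_eq_Re by simp

lemma norm_kern_le: "norm (kern a b) \<le> exp (- \<alpha> * (norm (a - b))\<^sup>2)"
  unfolding norm_kern using \<beta> by simp

lemma norm_kern_le_1: "norm (kern a b) \<le> 1"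
proof -
  have "0 \<le> \<alpha> * (norm (a - b))\<^sup>2" "0 \<le> \<beta> * (norm ((1/2) *\<^sub>R (a + b) - x))\<^sup>2"
    using \<alpha> \<beta> by simp_all
  then show ?thesis unfolding norm_kern by simp
qed

text \<open>The logarithmic derivative of the kernel in \<open>a\<close>, sorted so that it is affine in \<open>a\<close> and in \<open>b\<close>
separately. This form is what makes the class \<open>smears\<close> below closed under derivatives.\<close>

definition kern_log_deriv :: "'a \<Rightarrow> 'a \<Rightarrow> 'a \<Rightarrow> complex" where
  "kern_log_deriv a b h = - 2 * of_real pi * \<i> * of_real (k \<bullet> h) + of_real (\<beta> * (x \<bullet> h))
     + of_real (- (2 * \<alpha> + \<beta> / 2) * (a \<bullet> h)) + of_real ((2 * \<alpha> - \<beta> / 2) * (b \<bullet> h))"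

lemma kern_has_derivative: "((\<lambda>a. kern a b) has_derivative (\<lambda>h. kern a b * kern_log_deriv a b h)) (at a)"
  unfolding kern_def power2_norm_eq_inner kern_log_deriv_def
  by (rule has_derivative_exp_comp, (rule derivative_eq_intros refl)+)
     (auto simp: algebra_simps inner_commute)

lemma kern_mult_integrable:
  assumes r: "rapid r" shows "integrable lborel (\<lambda>b. kern a b * r b)"
  using rapid_measurable[OF r]
  by (intro Bochner_Integration.integrable_bound[OF rapid_integrable[OF r]])
     (auto simp: norm_mult intro!: mult_left_le_one_le norm_kern_le_1)

lemma smear_has_derivative:
  assumes r: "rapid r"
  shows "(smear r has_derivative (\<lambda>h. \<integral>b. kern a b * kern_log_deriv a b h * r b \<partial>lborel)) (at a)"
proof -
  note [measurable] = rapid_measurable[OF r]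
  define K where "K = 2 * pi * norm k + \<beta> * norm x + (2 * \<alpha> + \<beta> / 2) * (norm a + 1) + (2 * \<alpha> + \<beta> / 2)"
  have dlog_le: "norm (kern_log_deriv p b h) \<le> K * (1 + norm b) * norm h" if p: "p \<in> ball a 1" for p b h
  proof -
    have ip: "\<bar>c \<bullet> h\<bar> \<le> norm c * norm h" for c by (rule Cauchy_Schwarz_ineq2)
    have pa: "norm p \<le> norm a + 1" using p norm_triangle_sub[of p a] by (simp add: dist_norm norm_minus_commute)
    have "norm (kern_log_deriv p b h) \<le> norm (- 2 * of_real pi * \<i> * complex_of_real (k \<bullet> h)) + norm (complex_of_real (\<beta> * (x \<bullet> h)))
       + norm (complex_of_real (- (2 * \<alpha> + \<beta> / 2) * (p \<bullet> h))) + norm (complex_of_real ((2 * \<alpha> - \<beta> / 2) * (b \<bullet> h)))"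
      unfolding kern_log_deriv_def by (intro order.trans[OF norm_triangle_ineq] add_right_mono order.refl)
    also have "\<dots> = 2 * pi * \<bar>k \<bullet> h\<bar> + \<beta> * \<bar>x \<bullet> h\<bar> + (2 * \<alpha> + \<beta> / 2) * \<bar>p \<bullet> h\<bar> + \<bar>2 * \<alpha> - \<beta> / 2\<bar> * \<bar>b \<bullet> h\<bar>"
      unfolding norm_mult norm_of_real abs_mult using \<alpha> \<beta> by simp
    also have "\<dots> \<le> 2 * pi * (norm k * norm h) + \<beta> * (norm x * norm h)
        + (2 * \<alpha> + \<beta> / 2) * ((norm a + 1) * norm h) + (2 * \<alpha> + \<beta> / 2) * (norm b * norm h)"
      using \<alpha> \<beta> pa by (intro add_mono mult_mono ip order.trans[OF ip] mult_right_mono) auto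
    also have "\<dots> = (2 * pi * norm k + \<beta> * norm x + (2 * \<alpha> + \<beta> / 2) * (norm a + 1)
        + (2 * \<alpha> + \<beta> / 2) * norm b) * norm h"
      by (simp only: distrib_right mult.assoc)
    also have "\<dots> \<le> K * (1 + norm b) * norm h"
    proof -
      have *: "A + B * t \<le> (A + B) * (1 + t)" if "A \<ge> 0" "B \<ge> 0" "t \<ge> 0" for A B t :: real
        using that by (simp add: algebra_simps)
      show ?thesis unfolding K_def using \<alpha> \<beta> by (intro mult_right_mono *) (auto intro!: add_nonneg_nonneg)
    qed
    finally show ?thesis .
  qed
  have K0: "K \<ge> 0" unfolding K_def using \<alpha> \<beta> by (intro add_nonneg_nonneg mult_nonneg_nonneg) auto
  show ?thesis
    unfolding smear_def
  proof (rule has_derivative_integral_dominated[where B="\<lambda>b. K * ((1 + norm b) ^ 1 * norm (r b))"])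
    show "integrable lborel (\<lambda>b. kern a b * r b)" by (rule kern_mult_integrable[OF r])
    show "integrable lborel (\<lambda>b. K * ((1 + norm b) ^ 1 * norm (r b)))"
      by (intro integrable_mult_right rapid_integrable_weighted r)
    show "((\<lambda>p. kern p b * r b) has_derivative (\<lambda>h. kern p b * kern_log_deriv p b h * r b)) (at p)" for p b
      by (rule derivative_eq_intros kern_has_derivative refl)+ (simp add: ac_simps)
    show "norm (kern p b * kern_log_deriv p b h * r b) \<le> K * ((1 + norm b) ^ 1 * norm (r b)) * norm h"
      if "p \<in> ball a 1" for p b h
    proof -
      have "norm (kern p b * kern_log_deriv p b h * r b) \<le> 1 * (K * (1 + norm b) * norm h) * norm (r b)"
        unfolding norm_mult
        by (intro mult_mono norm_kern_le_1 dlog_le that) (use K0 in auto)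
      then show ?thesis by (simp add: ac_simps)
    qed
    show "0 \<le> K * ((1 + norm b) ^ 1 * norm (r b))" for b using K0 by simp
  qed (auto simp: kern_log_deriv_def)
qed

text \<open>A derivative falls on the Gaussian only and produces a factor affine in \<open>a\<close> and \<open>b\<close>: the part in
\<open>a\<close> leaves the integral, the part in \<open>b\<close> is absorbed into \<open>r\<close>, which stays rapidly decaying.\<close>

lemma smear_derivative_eq:
  assumes r: "rapid r"
  shows "(\<integral>b. kern a b * kern_log_deriv a b h * r b \<partial>lborel) =
    (- 2 * of_real pi * \<i> * of_real (k \<bullet> h) + of_real (\<beta> * (x \<bullet> h)) +
       of_real (- (2 * \<alpha> + \<beta> / 2)) * of_real (a \<bullet> h)) * smear r a
    + smear (\<lambda>b. of_real (2 * \<alpha> - \<beta> / 2) * (of_real (b \<bullet> h) * r b)) a"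
proof -
  let ?c = "- 2 * of_real pi * \<i> * of_real (k \<bullet> h) + of_real (\<beta> * (x \<bullet> h)) +
       of_real (- (2 * \<alpha> + \<beta> / 2)) * complex_of_real (a \<bullet> h)"
  have "(\<integral>b. kern a b * kern_log_deriv a b h * r b \<partial>lborel) = (\<integral>b. ?c * (kern a b * r b) +
      kern a b * (of_real (2 * \<alpha> - \<beta> / 2) * (of_real (b \<bullet> h) * r b)) \<partial>lborel)"
    by (intro Bochner_Integration.integral_cong refl) (simp add: kern_log_deriv_def algebra_simps)
  also have "\<dots> = (\<integral>b. ?c * (kern a b * r b) \<partial>lborel) +
      (\<integral>b. kern a b * (of_real (2 * \<alpha> - \<beta> / 2) * (of_real (b \<bullet> h) * r b)) \<partial>lborel)"
    by (intro Bochner_Integration.integral_add integrable_mult_right kern_mult_integrable r rapid_cmult rapid_inner_mult)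
  finally show ?thesis by (simp only: integral_mult_right_zero smear_def)
qed

inductive_set smears :: "('a \<Rightarrow> complex) set" where
  base: "rapid r \<Longrightarrow> smear r \<in> smears"
| add: "f \<in> smears \<Longrightarrow> g \<in> smears \<Longrightarrow> (\<lambda>a. f a + g a) \<in> smears"
| affine: "f \<in> smears \<Longrightarrow> (\<lambda>a. (c + d * of_real (a \<bullet> v)) * f a) \<in> smears"

lemma smears_derivative:
  assumes "f \<in> smears"
  shows "\<exists>D. \<forall>a. (f has_derivative D a) (at a) \<and> (\<forall>h. (\<lambda>a. D a h) \<in> smears)"
  using assms
proof induction
  case (base r)
  show ?case
  proof (intro exI allI conjI)
    show "(smear r has_derivative (\<lambda>h. \<integral>b. kern a b * kern_log_deriv a b h * r b \<partial>lborel)) (at a)" for a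
      by (rule smear_has_derivative[OF base])
    show "(\<lambda>a. \<integral>b. kern a b * kern_log_deriv a b h * r b \<partial>lborel) \<in> smears" for h
      unfolding smear_derivative_eq[OF base]
      by (intro smears.intros base rapid_cmult rapid_inner_mult)
  qed
next
  case (add f g)
  then obtain D1 D2 where D: "\<And>a. (f has_derivative D1 a) (at a)" "\<And>h. (\<lambda>a. D1 a h) \<in> smears"
    "\<And>a. (g has_derivative D2 a) (at a)" "\<And>h. (\<lambda>a. D2 a h) \<in> smears" by metis
  show ?case
    by (intro exI[of _ "\<lambda>a h. D1 a h + D2 a h"] conjI allI has_derivative_add D smears.add)
next
  case (affine f c d v)
  then obtain D where D: "\<And>a. (f has_derivative D a) (at a)" "\<And>h. (\<lambda>a. D a h) \<in> smears" by metis
  show ?case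
  proof (intro exI allI conjI)
    show "((\<lambda>a. (c + d * of_real (a \<bullet> v)) * f a) has_derivative
        (\<lambda>h. (c + d * of_real (a \<bullet> v)) * D a h + (d * of_real (h \<bullet> v) + 0 * of_real (a \<bullet> v)) * f a)) (at a)" for a
      by (rule derivative_eq_intros D refl)+ simp
    show "(\<lambda>a. (c + d * of_real (a \<bullet> v)) * D a h + (d * of_real (h \<bullet> v) + 0 * of_real (a \<bullet> v)) * f a) \<in> smears" for h
      by (intro smears.add smears.affine D affine)
  qed
qed

text \<open>Peetre's inequality \<open>1 + \<bar>a\<bar> \<le> (1 + \<bar>a - b\<bar>)(1 + \<bar>b\<bar>)\<close> splits the weight between the Gaussian in
\<open>a - b\<close> and the function \<open>r\<close>.\<close>

lemma smear_decay:
  assumes r: "rapid r" shows "\<exists>C. \<forall>a. (1 + norm a) ^ m * norm (smear r a) \<le> C"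
proof -
  note [measurable] = rapid_measurable[OF r]
  obtain C where C: "\<And>t::real. t \<ge> 0 \<Longrightarrow> (1 + t) ^ m * exp (- \<alpha> * t\<^sup>2) \<le> C"
    using power_times_gaussian_bounded[OF \<alpha>] by blast
  have le: "(1 + norm a) ^ m * norm (kern a b) \<le> C * (1 + norm b) ^ m" for a b
  proof -
    have "norm a \<le> norm (a - b) + norm b" using norm_triangle_ineq[of "a - b" b] by simp
    moreover have "0 \<le> norm (a - b) * norm b" by simp
    ultimately have "1 + norm a \<le> (1 + norm (a - b)) * (1 + norm b)" by (simp only: distrib_left distrib_right)
    then have "(1 + norm a) ^ m \<le> (1 + norm (a - b)) ^ m * (1 + norm b) ^ m"
      by (subst power_mult_distrib[symmetric]) (intro power_mono, auto)
    then have "(1 + norm a) ^ m * norm (kern a b)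
        \<le> ((1 + norm (a - b)) ^ m * (1 + norm b) ^ m) * exp (- \<alpha> * (norm (a - b))\<^sup>2)"
      by (intro mult_mono norm_kern_le) auto
    also have "\<dots> = ((1 + norm (a - b)) ^ m * exp (- \<alpha> * (norm (a - b))\<^sup>2)) * (1 + norm b) ^ m" by simp
    also have "\<dots> \<le> C * (1 + norm b) ^ m" by (intro mult_right_mono C) auto
    finally show ?thesis .
  qed
  show ?thesis
  proof (intro exI allI)
    fix a
    have "(1 + norm a) ^ m * norm (smear r a) = norm (\<integral>b. of_real ((1 + norm a) ^ m) * (kern a b * r b) \<partial>lborel)"
      by (simp only: smear_def integral_mult_right_zero norm_mult norm_of_real) simp
    also have "\<dots> \<le> (\<integral>b. norm (of_real ((1 + norm a) ^ m) * (kern a b * r b)) \<partial>lborel)"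
      by (rule integral_norm_bound)
    also have "\<dots> \<le> (\<integral>b. C * ((1 + norm b) ^ m * norm (r b)) \<partial>lborel)"
    proof (rule integral_mono)
      show "norm (of_real ((1 + norm a) ^ m) * (kern a b * r b)) \<le> C * ((1 + norm b) ^ m * norm (r b))" for b
        using mult_right_mono[OF le[of a b] norm_ge_zero[of "r b"]]
        by (simp add: norm_mult mult.assoc del: of_real_power of_real_add)
    qed (intro integrable_norm integrable_mult_right kern_mult_integrable rapid_integrable_weighted r)+
    finally show "(1 + norm a) ^ m * norm (smear r a) \<le> (\<integral>b. C * ((1 + norm b) ^ m * norm (r b)) \<partial>lborel)" .
  qed
qed

lemma smears_decay:
  assumes "f \<in> smears" shows "\<exists>C. \<forall>a. (1 + norm a) ^ m * norm (f a) \<le> C"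
proof -
  have "rapid f"
    using assms
  proof induction
    case (base r)
    have "continuous_on UNIV (smear r)"
      by (intro continuous_at_imp_continuous_on ballI has_derivative_continuous[OF smear_has_derivative[OF base]])
    then show ?case unfolding rapid_def using smear_decay[OF base] by (auto intro: borel_measurable_continuous_onI)
  next
    case (affine f c d v)
    then have "rapid (\<lambda>a. c * f a + d * (of_real (a \<bullet> v) * f a))"
      by (intro rapid_add rapid_cmult rapid_inner_mult)
    then show ?case by (simp add: algebra_simps)
  qed (rule rapid_add)
  then show ?thesis by (simp add: rapid_def)
qed

theorem smear_schwartz: assumes "rapid r" shows "schwartz (smear r)"
proof (rule schwartz_closed_class[where \<C>=smears])
  fix f assume f: "f \<in> smears"
  obtain D where D: "\<And>a. (f has_derivative D a) (at a)" "\<And>h. (\<lambda>a. D a h) \<in> smears"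
    using smears_derivative[OF f] by metis
  show "f differentiable at a" for a using D(1) differentiable_def by blast
  show "(\<lambda>x. frechet_derivative f (at x) v) \<in> smears" for v
    using D(2)[of v] by (simp add: frechet_derivative_at[OF D(1), symmetric])
qed (auto intro: smears.base assms smears_decay)

end

section \<open>Ambiguity functions\<close>

text \<open>The integral of \<open>x \<mapsto> h(x + s v)\<close> is the same for all \<open>s\<close>, and its derivative at \<open>s = 0\<close> can be taken
under the integral sign. This replaces integration by parts without a choice of coordinates.\<close>

lemma integral_directional_derivative_eq_0:
  fixes h :: "'a::euclidean_space \<Rightarrow> complex"
  assumes der: "\<And>x. (h has_derivative D x) (at x)" and int: "integrable lborel h"
    and meas [measurable]: "(\<lambda>x. D x v) \<in> borel_measurable borel"
    and bd: "\<And>x. norm (D x v) \<le> C / (1 + norm x) ^ (2 * DIM('a))" and C: "C \<ge> 0"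
  shows "(\<integral>x. D x v \<partial>lborel) = 0"
proof -
  let ?N = "2 * DIM('a)"
  define B where "B x = C * (1 + norm v) ^ ?N * (1 / (1 + norm x) ^ ?N)" for x :: 'a
  have [measurable]: "h \<in> borel_measurable borel" using borel_measurable_integrable[OF int] by simp
  have lin: "linear (D x)" for x by (rule has_derivative_linear[OF der])
  have "((\<lambda>s. \<integral>x. h (x + s *\<^sub>R v) \<partial>lborel) has_derivative (\<lambda>r. \<integral>x. r *\<^sub>R D (x + 0 *\<^sub>R v) v \<partial>lborel)) (at 0)"
  proof (rule has_derivative_integral_dominated[where B=B and D="\<lambda>s x r. r *\<^sub>R D (x + s *\<^sub>R v) v"])
    show "integrable lborel B"
      unfolding B_def by (intro integrable_mult_right integrable_inverse_power_norm)
    show "integrable lborel (\<lambda>x. h (x + 0 *\<^sub>R v))" using int by simp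
    show "0 \<le> B x" for x using C by (simp add: B_def)
    show "((\<lambda>s. h (x + s *\<^sub>R v)) has_derivative (\<lambda>r. r *\<^sub>R D (x + s *\<^sub>R v) v)) (at s)" for s x
    proof -
      have "((\<lambda>s. x + s *\<^sub>R v) has_derivative (\<lambda>r. r *\<^sub>R v)) (at s)"
        by (rule derivative_eq_intros refl)+ simp
      from has_derivative_compose[OF this der] show ?thesis by (simp add: linear_scale[OF lin])
    qed
    show "norm (r *\<^sub>R D (x + s *\<^sub>R v) v) \<le> B x * norm r" if s: "s \<in> ball 0 1" for s x r
    proof -
      have "norm (s *\<^sub>R v) \<le> norm v" using s by (simp add: mult_left_le_one_le)
      then have "norm x \<le> norm (x + s *\<^sub>R v) + norm v"
        using norm_triangle_ineq4[of "x + s *\<^sub>R v" "s *\<^sub>R v"] by simp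
      moreover have "0 \<le> norm (x + s *\<^sub>R v) * norm v" by simp
      ultimately have "1 + norm x \<le> (1 + norm v) * (1 + norm (x + s *\<^sub>R v))"
        by (simp only: distrib_left distrib_right mult.commute)
      then have "(1 + norm x) ^ ?N \<le> (1 + norm v) ^ ?N * (1 + norm (x + s *\<^sub>R v)) ^ ?N"
        by (subst power_mult_distrib[symmetric]) (intro power_mono, auto)
      moreover have "(1 + norm x) ^ ?N > 0" "(1 + norm (x + s *\<^sub>R v)) ^ ?N > 0"
        by (intro zero_less_power add_pos_nonneg; simp)+
      ultimately have "1 / (1 + norm (x + s *\<^sub>R v)) ^ ?N \<le> (1 + norm v) ^ ?N * (1 / (1 + norm x) ^ ?N)"
        by (simp add: field_simps)
      from mult_left_mono[OF this C] have "C / (1 + norm (x + s *\<^sub>R v)) ^ ?N \<le> B x"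
        by (simp add: B_def mult.assoc)
      with bd[of "x + s *\<^sub>R v"] have "norm (D (x + s *\<^sub>R v) v) \<le> B x" by linarith
      from mult_right_mono[OF this norm_ge_zero[of r]] show ?thesis by (simp add: mult.commute)
    qed
  qed auto
  moreover have "(\<integral>x. h (x + s *\<^sub>R v) \<partial>lborel) = (\<integral>x. h x \<partial>lborel)" for s
    using integral_lborel_affine(2)[of 1 h "s *\<^sub>R v"] by (simp add: add.commute)
  ultimately have "((\<lambda>s::real. \<integral>x. h x \<partial>lborel) has_derivative (\<lambda>r. \<integral>x. r *\<^sub>R D x v \<partial>lborel)) (at 0)"
    by simp
  from has_derivative_unique[OF this has_derivative_const] have "(\<lambda>r::real. \<integral>x. r *\<^sub>R D x v \<partial>lborel) = (\<lambda>r. 0)" .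
  from fun_cong[OF this, of 1] show ?thesis by simp
qed

text \<open>The cross-ambiguity function of radar theory, but bilinear: \<open>g\<close> is not conjugated.\<close>

definition ambiguity :: "('a::euclidean_space \<Rightarrow> complex) \<Rightarrow> ('a \<Rightarrow> complex) \<Rightarrow> 'a \<Rightarrow> 'a \<Rightarrow> complex" where
  "ambiguity f g S T = (\<integral>X. exp (2 * of_real pi * \<i> * of_real (S \<bullet> X)) *
      (f (X + (1/2) *\<^sub>R T) * g (X - (1/2) *\<^sub>R T)) \<partial>lborel)"

lemma norm_exp_two_pi_i [simp]: "norm (exp (2 * of_real pi * \<i> * of_real t)) = 1"
  "norm (exp (- (2 * of_real pi * \<i> * of_real t))) = 1"
  by (simp_all add: norm_exp_eq_Re)

text \<open>With \<open>A = X + T/2\<close> and \<open>B = X - T/2\<close>, the norms of \<open>T = A - B\<close> and of \<open>X = (A + B)/2\<close> are both at most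
\<open>\<bar>A\<bar> + \<bar>B\<bar>\<close>, so decay in \<open>A\<close> and \<open>B\<close> is decay in \<open>X\<close> and \<open>T\<close>.\<close>

lemma rapid_shifted_product_bound:
  fixes f g :: "'a::euclidean_space \<Rightarrow> complex"
  assumes "rapid f" "rapid g"
  obtains C where "C > 0" "\<And>X T. norm (f (X + (1/2) *\<^sub>R T) * g (X - (1/2) *\<^sub>R T)) \<le> C / ((1 + norm X) ^ m * (1 + norm T) ^ m)"
proof -
  obtain C1 where C1: "C1 > 0" "\<And>x. norm (f x) \<le> C1 / (1 + norm x) ^ (m + m)"
    using rapid_boundE[OF assms(1)] by blast
  obtain C2 where C2: "C2 > 0" "\<And>x. norm (g x) \<le> C2 / (1 + norm x) ^ (m + m)"
    using rapid_boundE[OF assms(2)] by blast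
  show ?thesis
  proof (rule that[of "C1 * C2"])
    show "C1 * C2 > 0" using C1 C2 by simp
    fix X T :: 'a
    let ?a = "X + (1/2) *\<^sub>R T" and ?b = "X - (1/2) *\<^sub>R T"
    have T: "norm T \<le> norm ?a + norm ?b"
    proof -
      have "?a - ?b = T" by (simp add: scaleR_add_left[symmetric])
      then show ?thesis using norm_triangle_ineq4[of ?a ?b] by simp
    qed
    have X: "norm X \<le> norm ?a + norm ?b"
    proof -
      have "?a + ?b = 2 *\<^sub>R X" by (simp add: scaleR_2)
      then have "2 * norm X \<le> norm ?a + norm ?b" using norm_triangle_ineq[of ?a ?b] by simp
      then show ?thesis using norm_ge_zero[of X] by linarith
    qed
    have *: "1 + t \<le> (1 + norm ?a) * (1 + norm ?b)" if "t \<le> norm ?a + norm ?b" for t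
    proof -
      have "0 \<le> norm ?a * norm ?b" by simp
      moreover have "(1 + norm ?a) * (1 + norm ?b) = 1 + norm ?a + norm ?b + norm ?a * norm ?b"
        by (simp only: distrib_left distrib_right)
      ultimately show ?thesis using that by linarith
    qed
    have "(1 + norm X) ^ m * (1 + norm T) ^ m \<le> ((1 + norm ?a) * (1 + norm ?b)) ^ m * ((1 + norm ?a) * (1 + norm ?b)) ^ m"
      by (intro mult_mono power_mono * X T) auto
    also have "\<dots> = (1 + norm ?a) ^ (m + m) * (1 + norm ?b) ^ (m + m)"
      by (simp only: power_mult_distrib power_add mult_ac)
    finally have le: "(1 + norm X) ^ m * (1 + norm T) ^ m \<le> (1 + norm ?a) ^ (m + m) * (1 + norm ?b) ^ (m + m)" .
    have pos: "(1 + norm X) ^ m * (1 + norm T) ^ m > 0"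
      by (intro mult_pos_pos zero_less_power add_pos_nonneg) auto
    have "norm (f ?a * g ?b) \<le> (C1 / (1 + norm ?a) ^ (m + m)) * (C2 / (1 + norm ?b) ^ (m + m))"
      unfolding norm_mult using C1 C2 by (intro mult_mono) (auto simp: less_imp_le)
    also have "\<dots> = (C1 * C2) / ((1 + norm ?a) ^ (m + m) * (1 + norm ?b) ^ (m + m))" by simp
    also have "\<dots> \<le> (C1 * C2) / ((1 + norm X) ^ m * (1 + norm T) ^ m)"
      using C1 C2 by (intro divide_left_mono le mult_pos_pos pos order.strict_trans2[OF pos le]) auto
    finally show "norm (f ?a * g ?b) \<le> C1 * C2 / ((1 + norm X) ^ m * (1 + norm T) ^ m)" .
  qed
qed

lemma integrable_ambiguity_integrand:
  fixes f g :: "'a::euclidean_space \<Rightarrow> complex"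
  assumes "rapid f" "rapid g"
  shows "integrable lborel (\<lambda>X. exp (2 * of_real pi * \<i> * of_real (S \<bullet> X)) *
      (f (X + (1/2) *\<^sub>R T) * g (X - (1/2) *\<^sub>R T)))"
proof -
  note [measurable] = assms[THEN rapid_measurable]
  obtain C where C: "C > 0" "\<And>X T. norm (f (X + (1/2) *\<^sub>R T) * g (X - (1/2) *\<^sub>R T))
      \<le> C / ((1 + norm X) ^ (2 * DIM('a)) * (1 + norm T) ^ (2 * DIM('a)))"
    using rapid_shifted_product_bound[OF assms] by blast
  show ?thesis
  proof (rule Bochner_Integration.integrable_bound)
    show "integrable lborel (\<lambda>X::'a. C / (1 + norm T) ^ (2 * DIM('a)) * (1 / (1 + norm X) ^ (2 * DIM('a))))"
      by (intro integrable_mult_right integrable_inverse_power_norm)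
  qed (use C in \<open>auto simp: norm_mult mult.commute\<close>)
qed

lemma ambiguity_bound:
  fixes f g :: "'a::euclidean_space \<Rightarrow> complex"
  assumes "rapid f" "rapid g"
  shows "\<exists>C. \<forall>S T. (1 + norm T) ^ M * norm (ambiguity f g S T) \<le> C"
proof -
  let ?N = "M + 2 * DIM('a)"
  obtain C where C: "C > 0" "\<And>X T. norm (f (X + (1/2) *\<^sub>R T) * g (X - (1/2) *\<^sub>R T))
      \<le> C / ((1 + norm X) ^ ?N * (1 + norm T) ^ ?N)"
    using rapid_shifted_product_bound[OF assms] by blast
  show ?thesis
  proof (intro exI allI)
    fix S T :: 'a
    have pT: "(1 + norm T) ^ j \<ge> 1" "(1 + norm T) ^ j > 0" for j
      by (intro one_le_power zero_less_power add_pos_nonneg; simp)+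
    have "norm (ambiguity f g S T) \<le> (\<integral>X. norm (exp (2 * of_real pi * \<i> * of_real (S \<bullet> X)) *
        (f (X + (1/2) *\<^sub>R T) * g (X - (1/2) *\<^sub>R T))) \<partial>lborel)"
      unfolding ambiguity_def by (rule integral_norm_bound)
    also have "\<dots> \<le> integral\<^sup>L lborel (\<lambda>X::'a. C / (1 + norm T) ^ M * (1 / (1 + norm X) ^ (2 * DIM('a))))"
    proof (rule integral_mono)
      fix X :: 'a
      have pX: "(1 + norm X) ^ j \<ge> 1" "(1 + norm X) ^ j > 0" for j
        by (intro one_le_power zero_less_power add_pos_nonneg; simp)+
      have "norm (f (X + (1/2) *\<^sub>R T) * g (X - (1/2) *\<^sub>R T)) \<le> C / ((1 + norm X) ^ ?N * (1 + norm T) ^ ?N)"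
        by (rule C)
      also have "\<dots> \<le> C / ((1 + norm X) ^ (2 * DIM('a)) * (1 + norm T) ^ M)"
        using C(1) pX pT by (intro divide_left_mono mult_mono power_increasing mult_pos_pos) (auto simp: less_imp_le)
      finally show "norm (exp (2 * of_real pi * \<i> * of_real (S \<bullet> X)) * (f (X + (1/2) *\<^sub>R T) * g (X - (1/2) *\<^sub>R T)))
        \<le> C / (1 + norm T) ^ M * (1 / (1 + norm X) ^ (2 * DIM('a)))"
        by (simp add: norm_mult mult.commute)
    qed (intro integrable_norm integrable_ambiguity_integrand assms integrable_mult_right integrable_inverse_power_norm)+
    also have "\<dots> = C / (1 + norm T) ^ M * integral\<^sup>L lborel (\<lambda>X::'a. 1 / (1 + norm X) ^ (2 * DIM('a)))"
      by (rule integral_mult_right_zero)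
    finally show "(1 + norm T) ^ M * norm (ambiguity f g S T) \<le> C * integral\<^sup>L lborel (\<lambda>X::'a. 1 / (1 + norm X) ^ (2 * DIM('a)))"
      using pT(2)[of M] by (simp add: field_simps)
  qed
qed

text \<open>The integral of the \<open>v\<close>-derivative in \<open>X\<close> of the integrand vanishes, and the product rule has three terms.\<close>

lemma ambiguity_derivative:
  fixes f g :: "'a::euclidean_space \<Rightarrow> complex"
  assumes f: "schwartz f" and g: "schwartz g" and v: "v \<in> Basis"
  shows "2 * of_real pi * \<i> * of_real (S \<bullet> v) * ambiguity f g S T =
    - (ambiguity (\<lambda>x. frechet_derivative f (at x) v) g S T + ambiguity f (\<lambda>x. frechet_derivative g (at x) v) S T)"
proof -
  let ?e = "\<lambda>X. exp (2 * of_real pi * \<i> * complex_of_real (S \<bullet> X))"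
  let ?a = "\<lambda>X. X + (1/2) *\<^sub>R T" and ?b = "\<lambda>X. X - (1/2) *\<^sub>R T"
  let ?f' = "\<lambda>x. frechet_derivative f (at x)" and ?g' = "\<lambda>x. frechet_derivative g (at x)"
  define D where "D X h = (2 * of_real pi * \<i> * of_real (S \<bullet> h)) * (?e X * (f (?a X) * g (?b X)))
     + (?e X * (?f' (?a X) h * g (?b X)) + ?e X * (f (?a X) * ?g' (?b X) h))" for X h
  note rf = schwartz_rapid[OF f] and rg = schwartz_rapid[OF g]
  note rf' = schwartz_rapid[OF schwartz_partial[OF f v]] and rg' = schwartz_rapid[OF schwartz_partial[OF g v]]
  note [measurable] = rf[THEN rapid_measurable] rg[THEN rapid_measurable] rf'[THEN rapid_measurable] rg'[THEN rapid_measurable]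
  let ?N = "2 * DIM('a)"
  have bd: "\<exists>C\<ge>0. \<forall>X. norm (c * (?e X * (F (?a X) * G (?b X)))) \<le> C / (1 + norm X) ^ ?N"
    if FG: "rapid F" "rapid G" for F G c
  proof -
    obtain C where C: "C > 0" "\<And>X T. norm (F (X + (1/2) *\<^sub>R T) * G (X - (1/2) *\<^sub>R T))
        \<le> C / ((1 + norm X) ^ ?N * (1 + norm T) ^ ?N)"
      using rapid_shifted_product_bound[OF FG] by blast
    have "norm (c * (?e X * (F (?a X) * G (?b X)))) \<le> (norm c * C / (1 + norm T) ^ ?N) / (1 + norm X) ^ ?N" for X
      using mult_left_mono[OF C(2)[of X T] norm_ge_zero[of c]] by (simp add: norm_mult mult.commute)
    then show ?thesis using C(1) by (intro exI[of _ "norm c * C / (1 + norm T) ^ ?N"]) auto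
  qed
  obtain C1 C2 C3 where C: "C1 \<ge> 0" "C2 \<ge> 0" "C3 \<ge> 0"
    "\<And>X. norm ((2 * of_real pi * \<i> * of_real (S \<bullet> v)) * (?e X * (f (?a X) * g (?b X)))) \<le> C1 / (1 + norm X) ^ ?N"
    "\<And>X. norm (1 * (?e X * (?f' (?a X) v * g (?b X)))) \<le> C2 / (1 + norm X) ^ ?N"
    "\<And>X. norm (1 * (?e X * (f (?a X) * ?g' (?b X) v))) \<le> C3 / (1 + norm X) ^ ?N"
    using bd[OF rf rg, of "2 * of_real pi * \<i> * of_real (S \<bullet> v)"] bd[OF rf' rg, of 1] bd[OF rf rg', of 1]
    by (elim exE conjE) blast
  have "(\<integral>X. D X v \<partial>lborel) = 0"
  proof (rule integral_directional_derivative_eq_0)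
    show "((\<lambda>X. ?e X * (f (?a X) * g (?b X))) has_derivative D X) (at X)" for X
    proof -
      have a: "((\<lambda>X. f (?a X)) has_derivative ?f' (?a X)) (at X)"
        by (rule has_derivative_compose[where g=f, OF _ schwartz_has_derivative[OF f], THEN has_derivative_eq_rhs])
           (rule derivative_eq_intros refl | simp)+
      have b: "((\<lambda>X. g (?b X)) has_derivative ?g' (?b X)) (at X)"
        by (rule has_derivative_compose[where g=g, OF _ schwartz_has_derivative[OF g], THEN has_derivative_eq_rhs])
           (rule derivative_eq_intros refl | simp)+
      have e: "(?e has_derivative (\<lambda>h. ?e X * (2 * of_real pi * \<i> * of_real (S \<bullet> h)))) (at X)"
        by (rule has_derivative_exp_comp) ((rule derivative_eq_intros refl)+, simp)
      show ?thesis
        by (rule has_derivative_mult[OF e has_derivative_mult[OF a b], THEN has_derivative_eq_rhs])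
           (simp add: D_def fun_eq_iff algebra_simps)
    qed
    show "integrable lborel (\<lambda>X. ?e X * (f (?a X) * g (?b X)))"
      by (rule integrable_ambiguity_integrand[OF rf rg])
    show "(\<lambda>X. D X v) \<in> borel_measurable borel" unfolding D_def by measurable
    show "norm (D X v) \<le> (C1 + (C2 + C3)) / (1 + norm X) ^ (2 * DIM('a))" for X
      unfolding D_def add_divide_distrib using C(4)[of X] C(5,6)[of X, unfolded mult_1]
      by (intro order.trans[OF norm_triangle_ineq] add_mono)
    show "C1 + (C2 + C3) \<ge> 0" using C by simp
  qed
  moreover have "(\<integral>X. D X v \<partial>lborel) = 2 * of_real pi * \<i> * of_real (S \<bullet> v) * ambiguity f g S T
      + (ambiguity (\<lambda>x. ?f' x v) g S T + ambiguity f (\<lambda>x. ?g' x v) S T)"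
  proof -
    have "(\<integral>X. D X v \<partial>lborel) = (\<integral>X. (2 * of_real pi * \<i> * of_real (S \<bullet> v)) * (?e X * (f (?a X) * g (?b X))) \<partial>lborel)
      + ((\<integral>X. ?e X * (?f' (?a X) v * g (?b X)) \<partial>lborel) + (\<integral>X. ?e X * (f (?a X) * ?g' (?b X) v) \<partial>lborel))"
      unfolding D_def
      using integrable_ambiguity_integrand[OF rf rg] integrable_ambiguity_integrand[OF rf' rg] integrable_ambiguity_integrand[OF rf rg']
      by (subst Bochner_Integration.integral_add, auto)+
    then show ?thesis by (simp only: ambiguity_def integral_mult_right_zero)
  qed
  ultimately show ?thesis by (simp only: eq_neg_iff_add_eq_0)
qed

text \<open>Induction on the power of \<open>1 + \<bar>S\<bar>\<close>, for all pairs of Schwartz functions at once: since \<open>\<bar>S\<bar>\<close> is at most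
the sum of the \<open>\<bar>S \<bullet> v\<bar>\<close>, one more power costs the ambiguity functions of first derivatives, which
are again ambiguity functions of Schwartz functions.\<close>

lemma ambiguity_decay:
  fixes f g :: "'a::euclidean_space \<Rightarrow> complex"
  assumes "schwartz f" "schwartz g"
  shows "\<exists>C. \<forall>S T. (1 + norm S) ^ j * ((1 + norm T) ^ M * norm (ambiguity f g S T)) \<le> C"
  using assms
proof (induction j arbitrary: f g)
  case 0
  then show ?case using ambiguity_bound[OF schwartz_rapid schwartz_rapid] by simp
next
  case (Suc j)
  let ?f' = "\<lambda>v x. frechet_derivative f (at x) v" and ?g' = "\<lambda>v x. frechet_derivative g (at x) v"
  let ?w = "\<lambda>S T z. (1 + norm S) ^ j * ((1 + norm T) ^ M * norm (z :: complex))"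
  have "\<forall>v\<in>Basis. \<exists>C. \<forall>S T. ?w S T (ambiguity (?f' v) g S T) \<le> C"
    using Suc.IH[OF schwartz_partial Suc.prems(2)] Suc.prems(1) by blast
  then obtain A where A: "\<And>v S T. v \<in> Basis \<Longrightarrow> ?w S T (ambiguity (?f' v) g S T) \<le> A v" by metis
  have "\<forall>v\<in>Basis. \<exists>C. \<forall>S T. ?w S T (ambiguity f (?g' v) S T) \<le> C"
    using Suc.IH[OF Suc.prems(1) schwartz_partial] Suc.prems(2) by blast
  then obtain B where B: "\<And>v S T. v \<in> Basis \<Longrightarrow> ?w S T (ambiguity f (?g' v) S T) \<le> B v" by metis
  obtain C where C: "\<And>S T. ?w S T (ambiguity f g S T) \<le> C" using Suc.IH[OF Suc.prems] by blast
  show ?case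
  proof (intro exI allI)
    fix S T :: 'a
    have v: "\<bar>S \<bullet> v\<bar> * ?w S T (ambiguity f g S T) \<le> A v + B v" if v: "v \<in> Basis" for v
    proof -
      have "2 * pi * (\<bar>S \<bullet> v\<bar> * norm (ambiguity f g S T)) = norm (2 * of_real pi * \<i> * of_real (S \<bullet> v) * ambiguity f g S T)"
        by (simp add: norm_mult)
      also have "\<dots> \<le> norm (ambiguity (?f' v) g S T) + norm (ambiguity f (?g' v) S T)"
        unfolding ambiguity_derivative[OF Suc.prems v] norm_minus_cancel by (rule norm_triangle_ineq)
      finally have "\<bar>S \<bullet> v\<bar> * norm (ambiguity f g S T) \<le> norm (ambiguity (?f' v) g S T) + norm (ambiguity f (?g' v) S T)"
        using mult_right_mono[of 1 "2 * pi" "\<bar>S \<bullet> v\<bar> * norm (ambiguity f g S T)"] pi_ge_two by simp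
      then have "(1 + norm S) ^ j * ((1 + norm T) ^ M * (\<bar>S \<bullet> v\<bar> * norm (ambiguity f g S T))) \<le>
         (1 + norm S) ^ j * ((1 + norm T) ^ M * (norm (ambiguity (?f' v) g S T) + norm (ambiguity f (?g' v) S T)))"
        by (intro mult_left_mono) auto
      also have "\<dots> \<le> A v + B v" using A[OF v, of S T] B[OF v, of S T] by (simp only: distrib_left)
      finally show ?thesis by (simp only: mult_ac)
    qed
    have "norm S \<le> (\<Sum>v\<in>Basis. \<bar>S \<bullet> v\<bar>)" by (rule norm_le_l1)
    then have "norm S * ?w S T (ambiguity f g S T) \<le> (\<Sum>v\<in>Basis. \<bar>S \<bullet> v\<bar>) * ?w S T (ambiguity f g S T)"
      by (intro mult_right_mono) auto
    also have "\<dots> \<le> (\<Sum>v\<in>Basis. A v + B v)" unfolding sum_distrib_right by (intro sum_mono v)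
    finally have "?w S T (ambiguity f g S T) + norm S * ?w S T (ambiguity f g S T) \<le> C + (\<Sum>v\<in>Basis. A v + B v)"
      by (intro add_mono C)
    then show "(1 + norm S) ^ Suc j * ((1 + norm T) ^ M * norm (ambiguity f g S T)) \<le> C + (\<Sum>v\<in>Basis. A v + B v)"
      by (simp only: power_Suc distrib_right mult.assoc mult_1)
  qed
qed

lemma ambiguity_integrable:
  fixes f g :: "'a::euclidean_space \<Rightarrow> complex"
  assumes f: "schwartz f" and g: "schwartz g"
  shows "integrable lborel (\<lambda>(S, T). ambiguity f g S T)"
    and "integrable lborel (\<lambda>S. ambiguity f g S T)"
proof -
  let ?N = "2 * DIM('a)"
  have cont: "continuous_on UNIV (\<lambda>(p, X). exp (2 * of_real pi * \<i> * of_real (fst p \<bullet> X)) *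
      (f (X + (1/2) *\<^sub>R snd p) * g (X - (1/2) *\<^sub>R snd p)))"
    unfolding split_beta
    by (intro continuous_intros continuous_on_compose2[OF schwartz_continuous[OF f]]
        continuous_on_compose2[OF schwartz_continuous[OF g]]) auto
  have "(\<lambda>p. ambiguity f g (fst p) (snd p)) \<in> borel_measurable lborel"
    unfolding ambiguity_def
    by (rule lborel.borel_measurable_lebesgue_integral)
       (use borel_measurable_continuous_onI[OF cont] in \<open>simp add: lborel_prod\<close>)
  then have [measurable]: "(\<lambda>p. ambiguity f g (fst p) (snd p)) \<in> borel_measurable borel" by simp
  have [measurable]: "(\<lambda>S. ambiguity f g S T) \<in> borel_measurable borel" for T
    using measurable_compose[of "\<lambda>S. (S, T)" borel borel, OF _ \<open>(\<lambda>p. ambiguity f g (fst p) (snd p)) \<in> borel_measurable borel\<close>]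
    by simp
  obtain C where C: "\<And>S T. (1 + norm S) ^ ?N * ((1 + norm T) ^ ?N * norm (ambiguity f g S T)) \<le> C"
    using ambiguity_decay[OF f g] by blast
  have le: "norm (ambiguity f g S T) \<le> (C * (1 / (1 + norm S) ^ ?N)) * (1 / (1 + norm T) ^ ?N)" for S T
  proof -
    have "(1 + norm S) ^ ?N > 0" "(1 + norm T) ^ ?N > 0"
      by (intro zero_less_power add_pos_nonneg; simp)+
    then show ?thesis using C[of S T] by (simp add: field_simps)
  qed
  show "integrable lborel (\<lambda>(S, T). ambiguity f g S T)"
  proof (rule Bochner_Integration.integrable_bound)
    show "integrable lborel (\<lambda>(S::'a, T::'a). (C * (1 / (1 + norm S) ^ ?N)) * (1 / (1 + norm T) ^ ?N))"
      by (intro integrable_pair_mult integrable_mult_right integrable_inverse_power_norm)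
    show "(\<lambda>(S, T). ambiguity f g S T) \<in> borel_measurable lborel" by (simp add: split_beta)
    show "AE p in lborel. norm (case p of (S, T) \<Rightarrow> ambiguity f g S T)
        \<le> norm (case p of (S, T) \<Rightarrow> (C * (1 / (1 + norm S) ^ ?N)) * (1 / (1 + norm T) ^ ?N))"
      unfolding split_beta real_norm_def by (intro AE_I2 order.trans[OF le abs_ge_self])
  qed
  show "integrable lborel (\<lambda>S. ambiguity f g S T)"
  proof (rule Bochner_Integration.integrable_bound)
    show "integrable lborel (\<lambda>S::'a. (C * (1 / (1 + norm S) ^ ?N)) * (1 / (1 + norm T) ^ ?N))"
      by (intro integrable_mult_left integrable_mult_right integrable_inverse_power_norm)
    show "AE S in lborel. norm (ambiguity f g S T) \<le> norm ((C * (1 / (1 + norm S) ^ ?N)) * (1 / (1 + norm T) ^ ?N))"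
      unfolding real_norm_def by (intro AE_I2 order.trans[OF le abs_ge_self])
  qed measurable
qed

text \<open>For fixed \<open>T\<close> the integral over \<open>S\<close> is Fourier inversion for \<open>f(\<cdot> + T/2) g(\<cdot> - T/2)\<close>; the integral
over \<open>T\<close> then becomes the right-hand side after the reflection \<open>T = -z\<close>.\<close>

theorem fourier_ambiguity:
  fixes f g :: "'a::euclidean_space \<Rightarrow> complex"
  assumes f: "schwartz f" and g: "schwartz g"
  shows "fourier (\<lambda>(S, T). ambiguity f g S T) (X, K) =
    (\<integral>z. exp (2 * of_real pi * \<i> * of_real (K \<bullet> z)) * f (X - (1/2) *\<^sub>R z) * g (X + (1/2) *\<^sub>R z) \<partial>lborel)"
proof -
  note [measurable] = schwartz_rapid[OF f, THEN rapid_measurable] schwartz_rapid[OF g, THEN rapid_measurable]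
  let ?e = "\<lambda>t. exp (- 2 * of_real pi * \<i> * complex_of_real t)"
  have e_add: "?e (s + t) = ?e s * ?e t" for s t
    unfolding exp_add[symmetric] by (simp only: of_real_add distrib_left)
  let ?F = "\<lambda>S T. ?e (K \<bullet> T) * (?e (S \<bullet> X) * ambiguity f g S T)"
  have meas: "(\<lambda>p. ambiguity f g (fst p) (snd p)) \<in> borel_measurable borel"
    using borel_measurable_integrable[OF ambiguity_integrable(1)[OF f g]] by (simp add: case_prod_beta')
  have "integrable (lborel \<Otimes>\<^sub>M lborel) (\<lambda>(S, T). ?F S T)"
    unfolding lborel_prod
  proof (rule Bochner_Integration.integrable_bound[OF ambiguity_integrable(1)[OF f g]])
    have "(\<lambda>p. ?F (fst p) (snd p)) \<in> borel_measurable borel"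
    proof (intro borel_measurable_times meas)
      show "(\<lambda>p. ?e (K \<bullet> snd p)) \<in> borel_measurable borel" "(\<lambda>p. ?e (fst p \<bullet> X)) \<in> borel_measurable borel"
        by (intro borel_measurable_continuous_onI continuous_intros)+
    qed
    then show "(\<lambda>(S, T). ?F S T) \<in> borel_measurable lborel" by (simp add: case_prod_beta')
  qed (auto simp: norm_mult split_beta)
  note int = this
  have inner: "(\<integral>S. ?F S T \<partial>lborel) = ?e (K \<bullet> T) * (f (X + (1/2) *\<^sub>R T) * g (X - (1/2) *\<^sub>R T))" for T
  proof -
    obtain C where C: "C > 0" "\<And>X T. norm (f (X + (1/2) *\<^sub>R T) * g (X - (1/2) *\<^sub>R T)) \<le> C / ((1 + norm X) ^ 0 * (1 + norm T) ^ 0)"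
      using rapid_shifted_product_bound[OF schwartz_rapid[OF f] schwartz_rapid[OF g]] by blast
    have "(\<integral>S. ?e (S \<bullet> X) * ambiguity f g S T \<partial>lborel) = f (X + (1/2) *\<^sub>R T) * g (X - (1/2) *\<^sub>R T)"
      unfolding ambiguity_def
    proof (rule fourier_inversion)
      show "continuous_on UNIV (\<lambda>X. f (X + (1/2) *\<^sub>R T) * g (X - (1/2) *\<^sub>R T))"
        by (intro continuous_intros continuous_on_compose2[OF schwartz_continuous[OF f]]
          continuous_on_compose2[OF schwartz_continuous[OF g]]) auto
      show "norm (f (X + (1/2) *\<^sub>R T) * g (X - (1/2) *\<^sub>R T)) \<le> C" for X using C(2)[of X T] by simp
      show "integrable lborel (\<lambda>X. f (X + (1/2) *\<^sub>R T) * g (X - (1/2) *\<^sub>R T))"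
        using integrable_ambiguity_integrand[OF schwartz_rapid[OF f] schwartz_rapid[OF g], of 0 T] by simp
      show "integrable lborel (\<lambda>s. \<integral>x. exp (2 * of_real pi * \<i> * of_real (s \<bullet> x)) *
          (f (x + (1/2) *\<^sub>R T) * g (x - (1/2) *\<^sub>R T)) \<partial>lborel)"
        using ambiguity_integrable(2)[OF f g, of T] unfolding ambiguity_def .
    qed
    then show ?thesis by (simp only: integral_mult_right_zero)
  qed
  have "fourier (\<lambda>(S, T). ambiguity f g S T) (X, K) = (\<integral>p. (\<lambda>(S, T). ?F S T) p \<partial>(lborel \<Otimes>\<^sub>M lborel))"
    unfolding fourier_def lborel_prod
  proof (intro Bochner_Integration.integral_cong refl)
    fix p :: "'a \<times> 'a"
    obtain S T where p: "p = (S, T)" by (cases p)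
    have "(X, K) \<bullet> p = K \<bullet> T + S \<bullet> X" by (simp add: p inner_commute)
    then show "?e ((X, K) \<bullet> p) * (case p of (S, T) \<Rightarrow> ambiguity f g S T) = (case p of (S, T) \<Rightarrow> ?F S T)"
      by (simp only: p prod.case e_add) (simp only: mult.assoc)
  qed
  also have "\<dots> = (\<integral>T. (\<integral>S. ?F S T \<partial>lborel) \<partial>lborel)"
    by (rule lborel_pair.integral_snd[symmetric, OF int])
  also have "\<dots> = (\<integral>T. ?e (K \<bullet> T) * (f (X + (1/2) *\<^sub>R T) * g (X - (1/2) *\<^sub>R T)) \<partial>lborel)"
    by (simp only: inner)
  also have "\<dots> = (\<integral>z. exp (2 * of_real pi * \<i> * of_real (K \<bullet> z)) * f (X - (1/2) *\<^sub>R z) * g (X + (1/2) *\<^sub>R z) \<partial>lborel)"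
    using integral_lborel_affine(2)[of "-1" "\<lambda>T. ?e (K \<bullet> T) * (f (X + (1/2) *\<^sub>R T) * g (X - (1/2) *\<^sub>R T))" 0]
    by (simp add: mult.assoc)
  finally show ?thesis .
qed


section \<open>Volume-preserving changes of variables\<close>

lemma distr_lborel_translate_reflect:
  fixes t :: "'a::euclidean_space"
  assumes "\<bar>c\<bar> = 1" shows "distr lborel borel (\<lambda>x. t + c *\<^sub>R x) = lborel"
  using lborel_affine[of c t] assms by (auto simp: density_1)

text \<open>The map is a composition of a translation of \<open>v\<close> for fixed \<open>y\<close>, giving \<open>(a, a - y)\<close>, and a
reflection of \<open>y\<close> for fixed \<open>a\<close>. Each preserves Lebesgue measure, and Tonelli's theorem joins them.\<close>

lemma distr_lborel_midpoint_difference: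
  "distr lborel borel (\<lambda>(v, y). (v + (1/2) *\<^sub>R y, v - (1/2) *\<^sub>R y)) = (lborel :: ('a::euclidean_space \<times> 'a) measure)"
proof (rule measure_eqI)
  fix A :: "('a \<times> 'a) set" assume "A \<in> sets (distr lborel borel (\<lambda>(v, y). (v + (1/2) *\<^sub>R y, v - (1/2) *\<^sub>R y)))"
  then have A: "A \<in> sets borel" by simp
  have ic [measurable]: "(\<lambda>p. indicator A (g p) :: ennreal) \<in> borel_measurable M" if "g \<in> borel_measurable M" for g :: "'b \<Rightarrow> 'a \<times> 'a" and M
    by (rule measurable_compose[OF that]) (use A in simp)
  have meas: "(\<lambda>(v, y). (v + (1/2) *\<^sub>R y, v - (1/2) *\<^sub>R y)) \<in> borel_measurable (borel :: ('a \<times> 'a) measure)"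
    unfolding split_beta by (intro borel_measurable_continuous_onI continuous_intros)
  have tr: "(\<integral>\<^sup>+x. F (t + c *\<^sub>R x) \<partial>lborel) = (\<integral>\<^sup>+x. F x \<partial>lborel)"
    if "\<bar>c\<bar> = 1" and [measurable]: "F \<in> borel_measurable borel" for F :: "'a \<Rightarrow> ennreal" and t c
    by (subst (2) distr_lborel_translate_reflect[OF that(1), of t, symmetric]) (simp add: nn_integral_distr)
  have pm: "g \<in> borel_measurable (lborel \<Otimes>\<^sub>M lborel)" if "continuous_on UNIV g" for g :: "'a \<times> 'a \<Rightarrow> 'a \<times> 'a"
    using borel_measurable_continuous_onI[OF that] by (simp add: lborel_prod)
  have "emeasure (distr lborel borel (\<lambda>(v, y). (v + (1/2) *\<^sub>R y, v - (1/2) *\<^sub>R y))) A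
      = (\<integral>\<^sup>+p. indicator A p \<partial>distr lborel borel (\<lambda>(v, y). (v + (1/2) *\<^sub>R y, v - (1/2) *\<^sub>R y)))"
    using A by simp
  also have "\<dots> = (\<integral>\<^sup>+p. indicator A ((\<lambda>(v, y). (v + (1/2) *\<^sub>R y, v - (1/2) *\<^sub>R y)) p) \<partial>lborel)"
    by (rule nn_integral_distr) (use A meas in simp_all)
  also have "\<dots> = (\<integral>\<^sup>+p. (\<lambda>(v, y). indicator A (v + (1/2) *\<^sub>R y, v - (1/2) *\<^sub>R y)) p \<partial>(lborel \<Otimes>\<^sub>M lborel))"
    by (simp add: lborel_prod split_beta)
  also have "\<dots> = (\<integral>\<^sup>+y. \<integral>\<^sup>+v. indicator A (v + (1/2) *\<^sub>R y, v - (1/2) *\<^sub>R y) \<partial>lborel \<partial>lborel)"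
    by (subst lborel_pair.nn_integral_snd[symmetric])
       (auto simp: split_beta intro!: ic pm continuous_intros)
  also have "\<dots> = (\<integral>\<^sup>+y. \<integral>\<^sup>+a. indicator A (a, a - y) \<partial>lborel \<partial>lborel)"
  proof (rule nn_integral_cong)
    fix y :: 'a
    have "(\<integral>\<^sup>+v. indicator A ((1/2) *\<^sub>R y + 1 *\<^sub>R v, ((1/2) *\<^sub>R y + 1 *\<^sub>R v) - y) \<partial>lborel)
        = (\<integral>\<^sup>+a. indicator A (a, a - y) \<partial>lborel)"
      by (rule tr) (auto intro!: ic borel_measurable_continuous_onI continuous_intros)
    moreover have "((1/2) *\<^sub>R y + 1 *\<^sub>R v, ((1/2) *\<^sub>R y + 1 *\<^sub>R v) - y) = (v + (1/2) *\<^sub>R y, v - (1/2) *\<^sub>R y)" for v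
    proof -
      have "y = (1/2) *\<^sub>R y + (1/2) *\<^sub>R y" by (simp add: scaleR_add_left[symmetric])
      then show ?thesis by (simp add: algebra_simps)
    qed
    ultimately show "(\<integral>\<^sup>+v. indicator A (v + (1/2) *\<^sub>R y, v - (1/2) *\<^sub>R y) \<partial>lborel)
        = (\<integral>\<^sup>+a. indicator A (a, a - y) \<partial>lborel)" by (simp only:)
  qed
  also have "\<dots> = (\<integral>\<^sup>+a. \<integral>\<^sup>+y. indicator A (a, a - y) \<partial>lborel \<partial>lborel)"
    by (rule lborel_pair.Fubini') (auto simp: split_beta intro!: ic pm continuous_intros)
  also have "\<dots> = (\<integral>\<^sup>+a. \<integral>\<^sup>+b. indicator A (a, b) \<partial>lborel \<partial>lborel)"
  proof (rule nn_integral_cong)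
    fix a :: 'a
    have "(\<integral>\<^sup>+y. indicator A (a, a + (-1) *\<^sub>R y) \<partial>lborel) = (\<integral>\<^sup>+b. indicator A (a, b) \<partial>lborel)"
      by (rule tr) (auto intro!: ic borel_measurable_continuous_onI continuous_intros)
    then show "(\<integral>\<^sup>+y. indicator A (a, a - y) \<partial>lborel) = (\<integral>\<^sup>+b. indicator A (a, b) \<partial>lborel)" by simp
  qed
  also have "\<dots> = (\<integral>\<^sup>+p. indicator A p \<partial>(lborel \<Otimes>\<^sub>M lborel))"
    by (subst lborel.nn_integral_fst) (use A in \<open>simp_all add: lborel_prod\<close>)
  also have "\<dots> = emeasure lborel A" using A by (simp add: lborel_prod)
  finally show "emeasure (distr lborel borel (\<lambda>(v, y). (v + (1/2) *\<^sub>R y, v - (1/2) *\<^sub>R y))) A = emeasure lborel A" .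
qed simp

lemma integral_midpoint_difference:
  fixes F :: "'a::euclidean_space \<times> 'a \<Rightarrow> 'c::{banach,second_countable_topology}"
  assumes "F \<in> borel_measurable borel"
  shows "(\<integral>p. (case p of (v, y) \<Rightarrow> F (v + (1/2) *\<^sub>R y, v - (1/2) *\<^sub>R y)) \<partial>lborel) = (\<integral>p. F p \<partial>lborel)"
proof -
  have "(\<lambda>(v, y). (v + (1/2) *\<^sub>R y, v - (1/2) *\<^sub>R y)) \<in> borel_measurable (borel :: ('a \<times> 'a) measure)"
    unfolding split_beta by (intro borel_measurable_continuous_onI continuous_intros)
  then show ?thesis
    using assms by (subst (2) distr_lborel_midpoint_difference[symmetric]) (simp add: integral_distr case_prod_beta')
qed

section \<open>The smoothed Wigner transform as a pairing\<close>

context gaussian_kernel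
begin

lemma kern_pair_integrable:
  assumes f: "rapid f" and r: "rapid r"
  shows "integrable lborel (\<lambda>(a, b). kern a b * (f a * r b))"
proof -
  note [measurable] = f[THEN rapid_measurable] r[THEN rapid_measurable]
  have i: "integrable lborel (\<lambda>(a, b). f a * r b)"
    by (rule integrable_pair_mult[OF rapid_integrable[OF f] rapid_integrable[OF r]])
  show ?thesis
  proof (rule Bochner_Integration.integrable_bound[OF i])
    have "(\<lambda>p. f (fst p) * r (snd p)) \<in> borel_measurable borel"
      using borel_measurable_integrable[OF i] by (simp add: case_prod_beta')
    then show "(\<lambda>(a, b). kern a b * (f a * r b)) \<in> borel_measurable lborel"
      by (simp add: case_prod_beta')
  qed (auto simp: norm_mult split_beta intro!: mult_left_le_one_le norm_kern_le_1)
qed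

text \<open>So the smoothed Wigner transform in its first argument is the pairing with \<open>smear r\<close>.\<close>

lemma integral_mult_smear:
  assumes f: "rapid f" and r: "rapid r"
  shows "(\<integral>p. (case p of (a, b) \<Rightarrow> kern a b * (f a * r b)) \<partial>lborel) = (\<integral>a. f a * smear r a \<partial>lborel)"
proof -
  have int: "integrable (lborel \<Otimes>\<^sub>M lborel) (\<lambda>(a, b). kern a b * (f a * r b))"
    using kern_pair_integrable[OF f r] by (simp add: lborel_prod)
  have "(\<integral>p. (case p of (a, b) \<Rightarrow> kern a b * (f a * r b)) \<partial>lborel)
      = (\<integral>a. (\<integral>b. kern a b * (f a * r b) \<partial>lborel) \<partial>lborel)"
    using lborel_pair.integral_fst'[OF int] by (simp add: lborel_prod)
  also have "\<dots> = (\<integral>a. f a * smear r a \<partial>lborel)"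
    unfolding smear_def integral_mult_right_zero[symmetric] by (simp only: mult.left_commute)
  finally show ?thesis .
qed

end

lemma smoothed_wigner_eq:
  fixes f g :: "real^'n::finite \<Rightarrow> complex"
  assumes "\<sigma>x > 0" "\<sigma>k > 0" and f: "rapid f" and g: "rapid g"
  defines "\<alpha> \<equiv> pi * \<sigma>k\<^sup>2 / 2" and "\<beta> \<equiv> 2 * pi / \<sigma>x\<^sup>2" and "c \<equiv> of_real ((sqrt 2 / \<sigma>x) ^ CARD('n))"
  shows "smoothed_wigner \<sigma>x \<sigma>k f g (x, k) =
    (\<integral>p. (case p of (a, b) \<Rightarrow> gaussian_kernel.kern \<alpha> \<beta> x k a b * (f a * (c * cnj (g b)))) \<partial>lborel)"
proof -
  interpret gaussian_kernel \<alpha> \<beta> x k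
    by unfold_locales (use assms in simp_all)
  let ?F = "\<lambda>p. case p of (a, b) \<Rightarrow> kern a b * (f a * (c * cnj (g b)))"
  have "integrable lborel ?F"
    by (intro kern_pair_integrable f rapid_cmult rapid_cnj g)
  then have "?F \<in> borel_measurable borel"
    using borel_measurable_integrable by force
  from integral_midpoint_difference[OF this]
  have "(\<integral>p. ?F p \<partial>lborel) = (\<integral>p. (case p of (v, y) \<Rightarrow>
      ?F (v + (1/2) *\<^sub>R y, v - (1/2) *\<^sub>R y)) \<partial>lborel)" by simp
  also have "\<dots> = (\<integral>p. c * (case p of (v, y) \<Rightarrow>
        exp (- 2 * of_real pi * \<i> * of_real (k \<bullet> y)
             - of_real (pi * \<sigma>k\<^sup>2 * (norm y)\<^sup>2 / 2)
             - of_real (2 * pi * (norm (v - x))\<^sup>2 / \<sigma>x\<^sup>2)) *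
        f (v + (1/2) *\<^sub>R y) * cnj (g (v - (1/2) *\<^sub>R y))) \<partial>lborel)"
  proof (intro Bochner_Integration.integral_cong refl)
    fix p :: "(real^'n) \<times> (real^'n)"
    obtain v y where p: "p = (v, y)" by (cases p)
    have "(v + (1/2) *\<^sub>R y) - (v - (1/2) *\<^sub>R y) = y" by (simp add: scaleR_add_left[symmetric])
    moreover have "(1/2) *\<^sub>R ((v + (1/2) *\<^sub>R y) + (v - (1/2) *\<^sub>R y)) = v"
      by (simp add: scaleR_2[symmetric])
    ultimately have "kern (v + (1/2) *\<^sub>R y) (v - (1/2) *\<^sub>R y) = exp (- 2 * of_real pi * \<i> * of_real (k \<bullet> y)
             - of_real (pi * \<sigma>k\<^sup>2 * (norm y)\<^sup>2 / 2) - of_real (2 * pi * (norm (v - x))\<^sup>2 / \<sigma>x\<^sup>2))"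
      unfolding kern_def by (simp only: \<alpha>_def \<beta>_def times_divide_eq_left)
    then show "(case p of (v, y) \<Rightarrow> ?F (v + (1/2) *\<^sub>R y, v - (1/2) *\<^sub>R y)) = c * (case p of (v, y) \<Rightarrow>
        exp (- 2 * of_real pi * \<i> * of_real (k \<bullet> y)
             - of_real (pi * \<sigma>k\<^sup>2 * (norm y)\<^sup>2 / 2)
             - of_real (2 * pi * (norm (v - x))\<^sup>2 / \<sigma>x\<^sup>2)) *
        f (v + (1/2) *\<^sub>R y) * cnj (g (v - (1/2) *\<^sub>R y)))"
      unfolding p by (simp only: prod.case mult_ac)
  qed
  also have "\<dots> = smoothed_wigner \<sigma>x \<sigma>k f g (x, k)"
    unfolding integral_mult_right_zero smoothed_wigner_def c_def by simp
  finally show ?thesis ..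
qed

text \<open>Exchanging \<open>a\<close> and \<open>b\<close> conjugates the kernel.\<close>

lemma smoothed_wigner_commute:
  fixes f g :: "real^'n::finite \<Rightarrow> complex"
  assumes "\<sigma>x > 0" "\<sigma>k > 0" and f: "rapid f" and g: "rapid g"
  shows "smoothed_wigner \<sigma>x \<sigma>k g f p = cnj (smoothed_wigner \<sigma>x \<sigma>k f g p)"
proof -
  obtain x k where p: "p = (x, k)" by (cases p)
  define \<alpha> where "\<alpha> = pi * \<sigma>k\<^sup>2 / 2"
  define \<beta> where "\<beta> = 2 * pi / \<sigma>x\<^sup>2"
  define c where "c = (sqrt 2 / \<sigma>x) ^ CARD('n)"
  interpret gaussian_kernel \<alpha> \<beta> x k
    by unfold_locales (use assms in \<open>simp_all add: \<alpha>_def \<beta>_def\<close>)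
  have W: "smoothed_wigner \<sigma>x \<sigma>k F G (x, k) =
      (\<integral>p. (case p of (a, b) \<Rightarrow> kern a b * (F a * (of_real c * cnj (G b)))) \<partial>lborel)"
    if "rapid F" "rapid G" for F G :: "real^'n \<Rightarrow> complex"
    unfolding \<alpha>_def \<beta>_def c_def by (rule smoothed_wigner_eq[OF assms(1,2) that])
  have cnj_kern: "cnj (kern a b) = kern b a" for a b
    unfolding kern_def exp_cnj
    by (simp add: norm_minus_commute[of b a] add.commute[of b a] inner_diff_right algebra_simps)
  have int: "integrable (lborel \<Otimes>\<^sub>M lborel) (\<lambda>(a, b). kern a b * (f a * (of_real c * cnj (g b))))"
    unfolding lborel_prod by (intro kern_pair_integrable f rapid_cmult rapid_cnj g)
  have "smoothed_wigner \<sigma>x \<sigma>k g f (x, k) =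
      (\<integral>p. cnj (case p of (b, a) \<Rightarrow> kern a b * (f a * (of_real c * cnj (g b)))) \<partial>lborel)"
    unfolding W[OF g f]
    by (intro Bochner_Integration.integral_cong refl) (auto simp: cnj_kern)
  also have "\<dots> = cnj (\<integral>p. (case p of (b, a) \<Rightarrow> kern a b * (f a * (of_real c * cnj (g b)))) \<partial>(lborel \<Otimes>\<^sub>M lborel))"
    by (simp add: lborel_prod)
  also have "(\<integral>p. (case p of (b, a) \<Rightarrow> kern a b * (f a * (of_real c * cnj (g b)))) \<partial>(lborel \<Otimes>\<^sub>M lborel))
     = smoothed_wigner \<sigma>x \<sigma>k f g (x, k)"
    using lborel_pair.integral_product_swap[OF borel_measurable_integrable[OF int]]
    unfolding W[OF f g] by (simp add: lborel_prod case_prod_beta')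
  finally show ?thesis unfolding p .
qed

section \<open>The entire extension\<close>

text \<open>One complex variable suffices: a point with real part \<open>\<xi>\<close> and imaginary part \<open>\<eta>\<close> is the value at
\<open>l = \<i>\<close> of the complex line \<open>l \<mapsto> \<xi> + l \<eta>\<close>, which is real for real \<open>l\<close>. The identity theorem on this
line applies.\<close>

lemma entire_eqI:
  assumes F: "entire F" and G: "entire G"
    and eq: "\<And>x k :: real^'n::finite. F (\<chi> j. of_real (x $ j), \<chi> j. of_real (k $ j)) = G (\<chi> j. of_real (x $ j), \<chi> j. of_real (k $ j))"
  shows "F = G"
proof
  fix p :: "(complex^'n) \<times> (complex^'n)"
  obtain z \<zeta> where p: "p = (z, \<zeta>)" by (cases p)
  define line where "line l = ((\<chi> j. of_real (Re (z $ j)) + l * of_real (Im (z $ j))) :: complex^'n,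
      (\<chi> j. of_real (Re (\<zeta> $ j)) + l * of_real (Im (\<zeta> $ j))) :: complex^'n)" for l :: complex
  define dz where "dz = (\<chi> j. of_real (Im (z $ j)) :: complex^'n)"
  define d\<zeta> where "d\<zeta> = (\<chi> j. of_real (Im (\<zeta> $ j)) :: complex^'n)"
  have hol: "(\<lambda>l. H (line l)) holomorphic_on UNIV" if H: "entire H" for H
  proof (rule holomorphic_onI)
    fix l
    obtain D where D: "(H has_derivative D) (at (line l))" "\<And>c a b. D (c *s a, c *s b) = c * D (a, b)"
      using H unfolding entire_def by blast
    have "bounded_linear (\<lambda>h. (h *s dz, h *s d\<zeta>))"
      unfolding linear_conv_bounded_linear[symmetric]
      by (rule linearI) (auto simp: vec_eq_iff algebra_simps)
    then have "((\<lambda>l. (\<chi> j. of_real (Re (z $ j)), \<chi> j. of_real (Re (\<zeta> $ j))) + (l *s dz, l *s d\<zeta>))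
        has_derivative (\<lambda>h. 0 + (h *s dz, h *s d\<zeta>))) (at l)"
      by (intro has_derivative_add has_derivative_const bounded_linear_imp_has_derivative)
    then have "(line has_derivative (\<lambda>h. (h *s dz, h *s d\<zeta>))) (at l)"
      by (simp add: line_def[abs_def] dz_def d\<zeta>_def vec_eq_iff plus_vec_def vector_scalar_mult_def)
    from has_derivative_compose[OF this D(1)] have "((\<lambda>l. H (line l)) has_derivative (\<lambda>h. D (dz, d\<zeta>) * h)) (at l)"
      by (simp add: D(2) mult.commute)
    then show "(\<lambda>l. H (line l)) field_differentiable at l within UNIV"
      by (auto simp: field_differentiable_def has_field_derivative_def)
  qed
  have "F (line \<i>) - G (line \<i>) = 0"
  proof (rule analytic_continuation[where f="\<lambda>l. F (line l) - G (line l)" and S=UNIV and U=\<real> and \<xi>=0])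
    show "(\<lambda>l. F (line l) - G (line l)) holomorphic_on UNIV"
      by (intro holomorphic_on_diff hol F G)
    show "(0::complex) islimpt \<real>"
    proof (unfold islimpt_sequential, intro exI conjI allI)
      show "complex_of_real (inverse (real (Suc n))) \<in> \<real> - {0}" for n by (simp del: of_nat_Suc)
      show "(\<lambda>n. complex_of_real (inverse (real (Suc n)))) \<longlonglongrightarrow> 0"
        using tendsto_of_real[OF LIMSEQ_inverse_real_of_nat, where 'a=complex] by simp
    qed
    show "F (line l) - G (line l) = 0" if l: "l \<in> \<real>" for l
    proof -
      obtain t :: real where t: "l = of_real t" using l by (auto simp: Reals_def)
      define x where "x = (\<chi> j. Re (z $ j) + t * Im (z $ j))"
      define k where "k = (\<chi> j. Re (\<zeta> $ j) + t * Im (\<zeta> $ j))"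
      have "line l = (\<chi> j. of_real (x $ j), \<chi> j. of_real (k $ j))"
        by (simp add: line_def t x_def k_def)
      then show ?thesis using eq[of x k] by simp
    qed
  qed auto
  moreover have "line \<i> = p"
    by (simp add: p line_def vec_eq_iff complex_eq[symmetric])
  ultimately show "F p = G p" by simp
qed

lemma power2_norm_eq_sum: "(norm v)\<^sup>2 = (\<Sum>j\<in>UNIV. (v $ j)\<^sup>2)" for v :: "real^'n::finite"
  unfolding power2_norm_eq_inner inner_vec_def by (simp add: power2_eq_square)

text \<open>The exponent of the Gaussian kernel with the phase point \<open>p\<close> complexified; \<open>q = (a, b)\<close> stays real.
It is written in coordinates because the squares have to be complex bilinear, not Hermitian.\<close>

definition complex_phase :: "real \<Rightarrow> real \<Rightarrow> (complex^'n::finite) \<times> (complex^'n) \<Rightarrow> (real^'n) \<times> (real^'n) \<Rightarrow> complex" where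
  "complex_phase \<alpha> \<beta> p q = (\<Sum>j\<in>UNIV.
     - 2 * of_real pi * \<i> * (snd p $ j * of_real (fst q $ j - snd q $ j))
     - of_real (\<alpha> * (fst q $ j - snd q $ j)\<^sup>2)
     - of_real \<beta> * (of_real ((fst q $ j + snd q $ j) / 2) - fst p $ j)\<^sup>2)"

lemma complex_phase_real:
  assumes "gaussian_kernel \<alpha> \<beta>"
  shows "exp (complex_phase \<alpha> \<beta> (\<chi> j. of_real (x $ j), \<chi> j. of_real (k $ j)) (a, b)) = gaussian_kernel.kern \<alpha> \<beta> x k a b"
proof -
  show ?thesis
    unfolding gaussian_kernel.kern_def[OF assms] complex_phase_def power2_norm_eq_sum inner_vec_def sum_distrib_left
      of_real_sum sum_subtractf[symmetric] fst_conv snd_conv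
    by (intro arg_cong[where f=exp] sum.cong refl) (simp add: add_divide_distrib)
qed

text \<open>The only linear growth in \<open>q\<close> comes from \<open>Im \<zeta>\<close> times \<open>a - b\<close>, and the Gaussian in \<open>a - b\<close> absorbs it
by completing the square. Hence the kernel stays bounded, locally uniformly in \<open>p\<close>.\<close>

lemma Re_complex_phase_le:
  assumes \<alpha>: "\<alpha> > 0" and \<beta>: "\<beta> > 0" and R: "norm p \<le> R"
  shows "Re (complex_phase \<alpha> \<beta> (p :: (complex^'n::finite) \<times> (complex^'n)) q) \<le> CARD('n) * ((pi\<^sup>2 / \<alpha> + \<beta>) * R\<^sup>2)"
proof -
  obtain z \<zeta> a b where pq: "p = (z, \<zeta>)" "q = (a, b)" by (cases p, cases q)
  have nz: "norm (z $ j) \<le> R" "norm (\<zeta> $ j) \<le> R" for j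
    using Finite_Cartesian_Product.norm_nth_le[of z j] Finite_Cartesian_Product.norm_nth_le[of \<zeta> j] norm_fst_le[of z \<zeta>] norm_snd_le[of \<zeta> z] R pq
    by (auto intro: order.trans)
  have term_le: "Re (- 2 * of_real pi * \<i> * (\<zeta> $ j * of_real (a $ j - b $ j))
     - of_real (\<alpha> * (a $ j - b $ j)\<^sup>2) - of_real \<beta> * (of_real ((a $ j + b $ j) / 2) - z $ j)\<^sup>2)
     \<le> (pi\<^sup>2 / \<alpha> + \<beta>) * R\<^sup>2" for j
  proof -
    define t where "t = a $ j - b $ j"
    define m where "m = (a $ j + b $ j) / 2 - Re (z $ j)"
    define y where "y = Im (\<zeta> $ j)"
    define w where "w = Im (z $ j)"
    have Re_sq: "Re (u\<^sup>2) = (Re u)\<^sup>2 - (Im u)\<^sup>2" for u :: complex by (simp add: power2_eq_square)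
    have "Re (- 2 * of_real pi * \<i> * (\<zeta> $ j * of_real (a $ j - b $ j))
       - of_real (\<alpha> * (a $ j - b $ j)\<^sup>2) - of_real \<beta> * (of_real ((a $ j + b $ j) / 2) - z $ j)\<^sup>2)
       = 2 * pi * y * t - \<alpha> * t\<^sup>2 - \<beta> * (m\<^sup>2 - w\<^sup>2)"
      unfolding minus_complex.simps Re_complex_of_real
      by (simp add: Re_sq t_def m_def y_def w_def)
    also have "\<dots> \<le> (pi\<^sup>2 / \<alpha>) * y\<^sup>2 + \<beta> * w\<^sup>2"
    proof -
      have "0 \<le> \<alpha> * (t - pi * y / \<alpha>)\<^sup>2" using \<alpha> by simp
      also have "\<dots> = \<alpha> * t\<^sup>2 - 2 * pi * y * t + (pi\<^sup>2 / \<alpha>) * y\<^sup>2"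
        using \<alpha> by (simp add: power2_eq_square field_simps)
      finally have "2 * pi * y * t - \<alpha> * t\<^sup>2 \<le> (pi\<^sup>2 / \<alpha>) * y\<^sup>2" by linarith
      moreover have "0 \<le> \<beta> * m\<^sup>2" using \<beta> by simp
      ultimately show ?thesis by (simp add: right_diff_distrib)
    qed
    also have "\<dots> \<le> (pi\<^sup>2 / \<alpha>) * R\<^sup>2 + \<beta> * R\<^sup>2"
    proof (intro add_mono mult_left_mono)
      show "y\<^sup>2 \<le> R\<^sup>2" using abs_Im_le_cmod[of "\<zeta> $ j"] nz(2)[of j]
        unfolding y_def by (intro power2_le_iff_abs_le[THEN iffD2]) auto
      show "w\<^sup>2 \<le> R\<^sup>2" using abs_Im_le_cmod[of "z $ j"] nz(1)[of j]
        unfolding w_def by (intro power2_le_iff_abs_le[THEN iffD2]) auto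
    qed (use \<alpha> \<beta> in auto)
    finally show ?thesis by (simp add: distrib_right)
  qed
  show ?thesis
    unfolding complex_phase_def pq Re_sum fst_conv snd_conv
    by (rule order.trans[OF sum_mono[OF term_le]]) simp
qed

definition complex_phase' :: "real \<Rightarrow> (complex^'n::finite) \<times> (complex^'n) \<Rightarrow> (real^'n) \<times> (real^'n) \<Rightarrow> (complex^'n) \<times> (complex^'n) \<Rightarrow> complex" where
  "complex_phase' \<beta> p q h = (\<Sum>j\<in>UNIV.
     - 2 * of_real pi * \<i> * (snd h $ j * of_real (fst q $ j - snd q $ j))
     + 2 * of_real \<beta> * ((of_real ((fst q $ j + snd q $ j) / 2) - fst p $ j) * fst h $ j))"

lemma complex_phase_has_derivative:
  fixes p :: "(complex^'n::finite) \<times> (complex^'n)"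
  shows "((\<lambda>p. complex_phase \<alpha> \<beta> p q) has_derivative complex_phase' \<beta> p q) (at p)"
proof -
  have 1: "((\<lambda>p. fst p $ j) has_derivative (\<lambda>h. fst h $ j)) (at p)" for p :: "(complex^'n) \<times> (complex^'n)" and j
    by (rule bounded_linear_imp_has_derivative) (rule bounded_linear_compose[OF bounded_linear_vec_nth bounded_linear_fst])
  have 2: "((\<lambda>p. snd p $ j) has_derivative (\<lambda>h. snd h $ j)) (at p)" for p :: "(complex^'n) \<times> (complex^'n)" and j
    by (rule bounded_linear_imp_has_derivative) (rule bounded_linear_compose[OF bounded_linear_vec_nth bounded_linear_snd])
  have eq: "A - 0 - B * (m * (0 - c) + (0 - c) * m) = A + 2 * B * (m * c)" for A B m c :: complex
    by (simp add: algebra_simps)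
  show ?thesis
    unfolding complex_phase_def complex_phase'_def[abs_def] power2_eq_square
    by (rule has_derivative_sum, (rule derivative_eq_intros 1 2 refl)+) (simp only: eq)
qed

lemma norm_complex_phase'_le:
  assumes \<beta>: "\<beta> > 0" and R: "norm p \<le> R"
  shows "norm (complex_phase' \<beta> (p :: (complex^'n::finite) \<times> (complex^'n)) (a, b) h)
    \<le> CARD('n) * (2 * pi + 2 * \<beta> * (1 + R)) * ((1 + norm a) * (1 + norm b)) * norm h"
proof -
  obtain z \<zeta> where p: "p = (z, \<zeta>)" by (cases p)
  obtain c d where h: "h = (c, d)" by (cases h)
  have R0: "R \<ge> 0" using R norm_ge_zero order.trans by blast
  have ab: "norm a + norm b \<le> (1 + norm a) * (1 + norm b)" "1 \<le> (1 + norm a) * (1 + norm b)"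
    by (simp_all add: algebra_simps)
  have t: "norm (- 2 * of_real pi * \<i> * (d $ j * of_real (a $ j - b $ j))
     + 2 * of_real \<beta> * ((of_real ((a $ j + b $ j) / 2) - z $ j) * c $ j))
     \<le> (2 * pi + 2 * \<beta> * (1 + R)) * ((1 + norm a) * (1 + norm b)) * norm h" for j
  proof -
    have c: "norm (c $ j) \<le> norm h" "norm (d $ j) \<le> norm h" "norm (z $ j) \<le> R"
      using Finite_Cartesian_Product.norm_nth_le[of c j] Finite_Cartesian_Product.norm_nth_le[of d j] norm_fst_le[of c d] norm_snd_le[of d c] h
        Finite_Cartesian_Product.norm_nth_le[of z j] norm_fst_le[of z \<zeta>] R p by (auto intro: order.trans)
    have aj: "\<bar>a $ j\<bar> \<le> norm a" "\<bar>b $ j\<bar> \<le> norm b" by (rule component_le_norm_cart)+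
    have "norm (- 2 * of_real pi * \<i> * (d $ j * of_real (a $ j - b $ j))) = 2 * pi * (norm (d $ j) * \<bar>a $ j - b $ j\<bar>)"
      by (simp add: norm_mult flip: of_real_diff)
    also have "\<dots> \<le> 2 * pi * (norm h * ((1 + norm a) * (1 + norm b)))"
      using aj ab by (intro mult_left_mono mult_mono c) auto
    finally have A: "norm (- 2 * of_real pi * \<i> * (d $ j * of_real (a $ j - b $ j))) \<le> 2 * pi * (norm h * ((1 + norm a) * (1 + norm b)))" .
    have "norm (of_real ((a $ j + b $ j) / 2) - z $ j) \<le> \<bar>(a $ j + b $ j) / 2\<bar> + R"
      using norm_triangle_ineq4[of "of_real ((a $ j + b $ j) / 2)" "z $ j"] c(3)
      unfolding norm_of_real by linarith
    also have "\<dots> \<le> 1 * ((1 + norm a) * (1 + norm b)) + R * ((1 + norm a) * (1 + norm b))"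
    proof -
      have "\<bar>(a $ j + b $ j) / 2\<bar> \<le> \<bar>a $ j\<bar> + \<bar>b $ j\<bar>"
      proof -
        have *: "s / 2 \<le> u + v" if "s \<le> u + v" "0 \<le> u" "0 \<le> v" for s u v :: real
          using that by linarith
        show ?thesis unfolding abs_divide abs_numeral by (intro * abs_triangle_ineq abs_ge_zero)
      qed
      then show ?thesis using aj ab mult_left_mono[OF ab(2) R0] by linarith
    qed
    finally have m: "norm (of_real ((a $ j + b $ j) / 2) - z $ j) \<le> (1 + R) * ((1 + norm a) * (1 + norm b))"
      by (simp only: distrib_right)
    have "norm (2 * of_real \<beta> * ((of_real ((a $ j + b $ j) / 2) - z $ j) * c $ j))
      = 2 * \<beta> * (norm (of_real ((a $ j + b $ j) / 2) - z $ j) * norm (c $ j))"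
      unfolding norm_mult norm_of_real using \<beta> by simp
    also have "\<dots> \<le> 2 * \<beta> * (((1 + R) * ((1 + norm a) * (1 + norm b))) * norm h)"
      using \<beta> R0 by (intro mult_left_mono mult_mono m c) auto
    finally have B: "norm (2 * of_real \<beta> * ((of_real ((a $ j + b $ j) / 2) - z $ j) * c $ j))
      \<le> 2 * \<beta> * (((1 + R) * ((1 + norm a) * (1 + norm b))) * norm h)" .
    have "2 * pi * (norm h * ((1 + norm a) * (1 + norm b))) + 2 * \<beta> * (((1 + R) * ((1 + norm a) * (1 + norm b))) * norm h)
      = (2 * pi + 2 * \<beta> * (1 + R)) * ((1 + norm a) * (1 + norm b)) * norm h"
    proof -
      have "2 * pi * (H * G) + 2 * \<beta> * (((1 + R) * G) * H) = (2 * pi + 2 * \<beta> * (1 + R)) * G * H" for G H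
        by (simp add: algebra_simps)
      then show ?thesis .
    qed
    then show ?thesis using order.trans[OF norm_triangle_ineq add_mono[OF A B]] by simp
  qed
  have "norm (complex_phase' \<beta> p (a, b) h) \<le> (\<Sum>j\<in>(UNIV::'n set). (2 * pi + 2 * \<beta> * (1 + R)) * ((1 + norm a) * (1 + norm b)) * norm h)"
    unfolding complex_phase'_def p h fst_conv snd_conv by (rule order.trans[OF norm_sum sum_mono]) (rule t[unfolded h])
  then show ?thesis by simp
qed

lemma complex_phase_measurable: "complex_phase \<alpha> \<beta> p \<in> borel_measurable borel"
  unfolding complex_phase_def by (intro borel_measurable_continuous_onI continuous_intros) auto

text \<open>The kernel is bounded and its derivative grows linearly in \<open>a\<close> and in \<open>b\<close>, locally uniformly in \<open>p\<close>,
so the decay of \<open>f\<close> and \<open>r\<close> allows differentiation under the integral sign. The derivative is complex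
linear because that of \<open>complex_phase\<close> is.\<close>

lemma entire_gaussian_integral:
  fixes f r :: "real^'n::finite \<Rightarrow> complex"
  assumes \<alpha>: "\<alpha> > 0" and \<beta>: "\<beta> > 0" and f: "rapid f" and r: "rapid r"
  shows "entire (\<lambda>p. \<integral>q. exp (complex_phase \<alpha> \<beta> p q) * (f (fst q) * r (snd q)) \<partial>lborel)"
  unfolding entire_def
proof (intro allI exI conjI)
  fix p0 :: "(complex^'n) \<times> (complex^'n)"
  define D where "D p q h = exp (complex_phase \<alpha> \<beta> p q) * complex_phase' \<beta> p q h * (f (fst q) * r (snd q))" for p q h
  define R where "R = norm p0 + 1"
  define M where "M = exp (CARD('n) * ((pi\<^sup>2 / \<alpha> + \<beta>) * R\<^sup>2))"
  define K where "K = CARD('n) * (2 * pi + 2 * \<beta> * (1 + R))"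
  define B where "B q = (M * K) * ((1 + norm (fst q)) ^ 1 * norm (f (fst q)) * ((1 + norm (snd q)) ^ 1 * norm (r (snd q))))" for q :: "(real^'n) \<times> (real^'n)"
  have K0: "K \<ge> 0" using \<beta> by (simp add: K_def R_def)
  have M0: "M \<ge> 0" by (simp add: M_def)
  have pR: "norm p \<le> R" if "p \<in> ball p0 1" for p
    using that norm_triangle_sub[of p p0] by (simp add: R_def dist_norm norm_minus_commute)
  have ifr: "integrable lborel (\<lambda>(a, b). f a * r b)"
    by (rule integrable_pair_mult[OF rapid_integrable[OF f] rapid_integrable[OF r]])
  have mfr [measurable]: "(\<lambda>q. f (fst q) * r (snd q)) \<in> borel_measurable borel"
    using borel_measurable_integrable[OF ifr] by (simp add: case_prod_beta')
  note [measurable] = complex_phase_measurable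
  have eM: "norm (exp (complex_phase \<alpha> \<beta> p q)) \<le> M" if "p \<in> ball p0 1" for p q
    unfolding norm_exp_eq_Re M_def exp_le_cancel_iff by (rule Re_complex_phase_le[OF \<alpha> \<beta> pR[OF that]])
  show "((\<lambda>p. \<integral>q. exp (complex_phase \<alpha> \<beta> p q) * (f (fst q) * r (snd q)) \<partial>lborel) has_derivative
      (\<lambda>h. \<integral>q. D p0 q h \<partial>lborel)) (at p0)"
  proof (rule has_derivative_integral_dominated[where B=B])
    show "(\<lambda>q. D p0 q h) \<in> borel_measurable lborel" for h
    proof -
      have [measurable]: "(\<lambda>q. complex_phase' \<beta> p0 q h) \<in> borel_measurable borel"
        unfolding complex_phase'_def by (intro borel_measurable_continuous_onI continuous_intros) auto
      show ?thesis unfolding D_def by measurable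
    qed
    show "integrable lborel (\<lambda>q. exp (complex_phase \<alpha> \<beta> p0 q) * (f (fst q) * r (snd q)))"
    proof (rule Bochner_Integration.integrable_bound)
      show "integrable lborel (\<lambda>q. of_real M * (f (fst q) * r (snd q)))"
        using ifr by (intro integrable_mult_right) (simp add: case_prod_beta')
      have "norm (exp (complex_phase \<alpha> \<beta> p0 q) * (f (fst q) * r (snd q))) \<le> norm (of_real M * (f (fst q) * r (snd q)))" for q
        unfolding norm_mult norm_of_real using eM[of p0 q] M0 by (intro mult_right_mono) auto
      then show "AE q in lborel. norm (exp (complex_phase \<alpha> \<beta> p0 q) * (f (fst q) * r (snd q))) \<le> norm (of_real M * (f (fst q) * r (snd q)))"
        by simp
    qed measurable
    show "integrable lborel B"
      using integrable_pair_mult[OF rapid_integrable_weighted[OF f, of 1] rapid_integrable_weighted[OF r, of 1]]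
      unfolding B_def by (intro integrable_mult_right) (simp add: case_prod_beta')
    show "0 \<le> B q" for q unfolding B_def using K0 M0 by simp
    show "((\<lambda>p. exp (complex_phase \<alpha> \<beta> p q) * (f (fst q) * r (snd q))) has_derivative D p q) (at p)" for p q
      unfolding D_def
      by (rule has_derivative_mult_left[OF has_derivative_exp_comp[OF complex_phase_has_derivative]])
    show "norm (D p q h) \<le> B q * norm h" if p: "p \<in> ball p0 1" for p q h
    proof -
      have "norm (D p q h) \<le> M * (K * ((1 + norm (fst q)) * (1 + norm (snd q))) * norm h) * norm (f (fst q) * r (snd q))"
        unfolding D_def norm_mult[of _ "f _ * r _"] norm_mult[of "exp _"]
        using norm_complex_phase'_le[OF \<beta> pR[OF p], of "fst q" "snd q" h] eM[OF p, of q] M0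
        by (intro mult_right_mono mult_mono) (auto simp: K_def)
      also have "\<dots> = B q * norm h" by (simp add: B_def norm_mult mult_ac)
      finally show ?thesis .
    qed
  qed measurable
  show "(\<integral>q. D p0 q (c *s a, c *s b) \<partial>lborel) = c * (\<integral>q. D p0 q (a, b) \<partial>lborel)" for c a b
  proof -
    have "complex_phase' \<beta> p0 q (c *s a, c *s b) = c * complex_phase' \<beta> p0 q (a, b)" for q
      unfolding complex_phase'_def sum_distrib_left
      by (intro sum.cong refl) (simp add: algebra_simps)
    then have "D p0 q (c *s a, c *s b) = c * D p0 q (a, b)" for q by (simp add: D_def)
    then show ?thesis by simp
  qed
qed

section \<open>Smoothed operators as Weyl operators\<close>

text \<open>One coordinate of the exponents, with \<open>P = \<pi>\<close>, \<open>j = \<i>\<close>, \<open>s = \<sigma>x\<^sup>2\<close> and \<open>q = \<sigma>k\<^sup>2\<close>. On the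
left: the prefactor of the smoothed operator and the complexified Gaussian at its shifted argument.
On the right: an oscillation in \<open>S\<close> and the Gaussian at the unshifted phase point with \<open>a\<close> translated
by \<open>T\<close>. The relation between \<open>\<beta>\<close> and \<open>s\<close> is what cancels all quadratic terms in \<open>S\<close>.\<close>

lemma phase_shift_identity:
  fixes P j :: complex
  assumes j: "j * j = -1" and \<beta>: "\<beta> * s = 2 * P"
  shows "2 * P * j * (S * x + T * k) - P / 2 * (s * S\<^sup>2 + q * T\<^sup>2)
     + (- 2 * P * j * ((k - (S - j * (q * T)) / 2) * (a - b)) - P * q / 2 * (a - b)\<^sup>2
        - \<beta> * ((a + b) / 2 - (x + (T + j * (s * S)) / 2))\<^sup>2)
   = 2 * P * j * (S * (a - T / 2))
     + (- 2 * P * j * (k * ((a - T) - b)) - P * q / 2 * ((a - T) - b)\<^sup>2 - \<beta> * (((a - T) + b) / 2 - x)\<^sup>2)"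
proof -
  \<comment> \<open>Halving the variables clears the denominators, so that the claim becomes a ring identity.\<close>
  have halves: "\<exists>y'. y = 2 * y'" for y :: complex by (rule exI[of _ "y / 2"]) simp
  obtain S' T' a' b' q' where h: "S = 2 * S'" "T = 2 * T'" "a = 2 * a'" "b = 2 * b'" "q = 2 * q'"
    using halves by metis
  have "2 * P * j * (2 * S' * x + 2 * T' * k) - P * (2 * s * S'\<^sup>2 + 4 * q' * T'\<^sup>2)
     + (- 2 * P * j * ((k - (S' - 2 * j * q' * T')) * (2 * a' - 2 * b')) - P * q' * (2 * a' - 2 * b')\<^sup>2
        - \<beta> * ((a' + b') - (x + (T' + j * s * S')))\<^sup>2)
   = 2 * P * j * (2 * S' * (2 * a' - T'))
     + (- 2 * P * j * (k * ((2 * a' - 2 * T') - 2 * b')) - P * q' * ((2 * a' - 2 * T') - 2 * b')\<^sup>2 - \<beta> * ((a' - T' + b') - x)\<^sup>2)"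
    using j \<beta> by algebra
  moreover have "P / 2 * (s * (2 * S')\<^sup>2 + 2 * q' * (2 * T')\<^sup>2) = P * (2 * s * S'\<^sup>2 + 4 * q' * T'\<^sup>2)"
    by (simp add: field_simps power2_eq_square)
  moreover have "(2 * S' - j * (2 * q' * (2 * T'))) / 2 = S' - 2 * j * q' * T'"
    "(2 * a' + 2 * b') / 2 = a' + b'" "(2 * T' + j * (s * (2 * S'))) / 2 = T' + j * s * S'"
    "2 * T' / 2 = T'" "(2 * a' - 2 * T' + 2 * b') / 2 = a' - T' + b'" "P * (2 * q') / 2 = P * q'"
    by (simp_all add: field_simps)
  ultimately show ?thesis unfolding h by (simp only: mult.assoc)
qed

context gaussian_kernel
begin

text \<open>Integrating \<open>b\<close> out gives \<open>smear r\<close> at \<open>a - T\<close>; then \<open>a = X + T/2\<close> makes the arguments symmetric.\<close>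

lemma integral_shifted_kern:
  assumes f: "rapid f" and r: "rapid r"
  shows "(\<integral>p. (case p of (a, b) \<Rightarrow> exp (2 * of_real pi * \<i> * of_real (S \<bullet> (a - (1/2) *\<^sub>R T))) * kern (a - T) b * (f a * r b)) \<partial>lborel)
    = ambiguity f (smear r) S T"
proof -
  note [measurable] = f[THEN rapid_measurable] r[THEN rapid_measurable] 
    rapid_measurable[OF schwartz_rapid[OF smear_schwartz[OF r]]]
  let ?e = "\<lambda>a. exp (2 * of_real pi * \<i> * of_real (S \<bullet> (a - (1/2) *\<^sub>R T)))"
  have i: "integrable lborel (\<lambda>(a, b). f a * r b)"
    by (rule integrable_pair_mult[OF rapid_integrable[OF f] rapid_integrable[OF r]])
  have "integrable lborel (\<lambda>(a, b). ?e a * kern (a - T) b * (f a * r b))"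
  proof (rule Bochner_Integration.integrable_bound[OF i])
    have "(\<lambda>p. f (fst p) * r (snd p)) \<in> borel_measurable borel"
      using borel_measurable_integrable[OF i] by (simp add: case_prod_beta')
    moreover have "(\<lambda>p. ?e (fst p) * kern (fst p - T) (snd p)) \<in> borel_measurable borel"
      unfolding kern_def by (intro borel_measurable_continuous_onI continuous_intros)
    ultimately have "(\<lambda>p. ?e (fst p) * kern (fst p - T) (snd p) * (f (fst p) * r (snd p))) \<in> borel_measurable borel"
      by (rule borel_measurable_times[rotated])
    then show "(\<lambda>(a, b). ?e a * kern (a - T) b * (f a * r b)) \<in> borel_measurable lborel"
      by (simp add: case_prod_beta')
  qed (auto simp: norm_mult split_beta intro!: mult_left_le_one_le norm_kern_le_1)
  then have int: "integrable (lborel \<Otimes>\<^sub>M lborel) (\<lambda>(a, b). ?e a * kern (a - T) b * (f a * r b))"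
    by (simp add: lborel_prod)
  have "(\<integral>p. (case p of (a, b) \<Rightarrow> ?e a * kern (a - T) b * (f a * r b)) \<partial>lborel)
      = (\<integral>a. (\<integral>b. ?e a * kern (a - T) b * (f a * r b) \<partial>lborel) \<partial>lborel)"
    using lborel_pair.integral_fst'[OF int] by (simp add: lborel_prod)
  also have "\<dots> = (\<integral>a. ?e a * (f a * smear r (a - T)) \<partial>lborel)"
  proof (rule Bochner_Integration.integral_cong[OF refl])
    fix a
    have "?e a * kern (a - T) b * (f a * r b) = ?e a * f a * (kern (a - T) b * r b)" for b by simp
    then show "(\<integral>b. ?e a * kern (a - T) b * (f a * r b) \<partial>lborel) = ?e a * (f a * smear r (a - T))"
      by (simp only: smear_def integral_mult_right_zero mult.assoc)
  qed
  also have "\<dots> = (\<integral>X. ?e ((1/2) *\<^sub>R T + 1 *\<^sub>R X) * (f ((1/2) *\<^sub>R T + 1 *\<^sub>R X) * smear r ((1/2) *\<^sub>R T + 1 *\<^sub>R X - T)) \<partial>lborel)"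
    by (subst integral_lborel_affine(2)[where f="\<lambda>a. ?e a * (f a * smear r (a - T))"]) auto
  also have "\<dots> = ambiguity f (smear r) S T"
    unfolding ambiguity_def
  proof (rule Bochner_Integration.integral_cong[OF refl])
    fix X
    have "(1/2) *\<^sub>R T + 1 *\<^sub>R X - (1/2) *\<^sub>R T = X" "(1/2) *\<^sub>R T + 1 *\<^sub>R X = X + (1/2) *\<^sub>R T" by simp_all
    moreover have "T = (1/2) *\<^sub>R T + (1/2) *\<^sub>R T" by (simp add: scaleR_add_left[symmetric])
    then have "X + (1/2) *\<^sub>R T - T = X - (1/2) *\<^sub>R T" by (metis add_diff_cancel_right' diff_add_eq_diff_diff_swap)
    ultimately show "?e ((1/2) *\<^sub>R T + 1 *\<^sub>R X) * (f ((1/2) *\<^sub>R T + 1 *\<^sub>R X) * smear r ((1/2) *\<^sub>R T + 1 *\<^sub>R X - T))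
      = exp (2 * of_real pi * \<i> * of_real (S \<bullet> X)) * (f (X + (1/2) *\<^sub>R T) * smear r (X - (1/2) *\<^sub>R T))"
      by (simp only: add_diff_cancel_right')
  qed
  finally show ?thesis .
qed

end

lemma complex_phase_shift:
  fixes x k S T a b :: "real^'n::finite"
  assumes "\<sigma>x > 0" "\<sigma>k > 0"
  defines "\<alpha> \<equiv> pi * \<sigma>k\<^sup>2 / 2" and "\<beta> \<equiv> 2 * pi / \<sigma>x\<^sup>2"
  shows "exp (2 * of_real pi * \<i> * of_real (S \<bullet> x + T \<bullet> k)
            - of_real (pi / 2 * (\<sigma>x\<^sup>2 * (norm S)\<^sup>2 + \<sigma>k\<^sup>2 * (norm T)\<^sup>2))) *
      exp (complex_phase \<alpha> \<beta>
        (\<chi> j. of_real (x $ j) + (of_real (T $ j) + \<i> * of_real (\<sigma>x\<^sup>2 * S $ j)) / 2,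
          \<chi> j. of_real (k $ j) - (of_real (S $ j) - \<i> * of_real (\<sigma>k\<^sup>2 * T $ j)) / 2) (a, b))
    = exp (2 * of_real pi * \<i> * of_real (S \<bullet> (a - (1/2) *\<^sub>R T))) * gaussian_kernel.kern \<alpha> \<beta> x k (a - T) b"
proof -
  have gk: "gaussian_kernel \<alpha> \<beta>" by unfold_locales (use assms in simp_all)
  have ip: "u \<bullet> v = (\<Sum>j\<in>UNIV. u $ j * v $ j)" for u v :: "real^'n"
    by (simp add: inner_vec_def)
  let ?P = "complex_of_real pi"
  have \<beta>s: "complex_of_real \<beta> * of_real (\<sigma>x\<^sup>2) = 2 * ?P"
    using assms(1) by (simp add: \<beta>_def)
  have \<alpha>': "complex_of_real \<alpha> = ?P * of_real (\<sigma>k\<^sup>2) / 2" by (simp add: \<alpha>_def)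
  note shift = phase_shift_identity[OF complex_i_mult_minus[of 1, unfolded mult_1_right] \<beta>s]
  show ?thesis
    unfolding complex_phase_real[OF gk, symmetric] exp_add[symmetric] complex_phase_def power2_norm_eq_sum ip fst_conv snd_conv
      sum_distrib_left of_real_sum sum.distrib[symmetric] sum_subtractf[symmetric]
    by (intro arg_cong[where f=exp] sum.cong refl)
       (use shift in \<open>simp add: \<alpha>'\<close>)
qed

lemma entire_extension_smoothed_wigner:
  fixes f g :: "real^'n::finite \<Rightarrow> complex"
  assumes \<sigma>: "\<sigma>x > 0" "\<sigma>k > 0" and f: "rapid f" and g: "rapid g"
  defines "\<alpha> \<equiv> pi * \<sigma>k\<^sup>2 / 2" and "\<beta> \<equiv> 2 * pi / \<sigma>x\<^sup>2" and "c \<equiv> of_real ((sqrt 2 / \<sigma>x) ^ CARD('n))"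
  shows "entire_extension (smoothed_wigner \<sigma>x \<sigma>k f g) =
    (\<lambda>p. \<integral>q. exp (complex_phase \<alpha> \<beta> p q) * (f (fst q) * (c * cnj (g (snd q)))) \<partial>lborel)" (is "_ = ?F")
  unfolding entire_extension_def
proof (rule the_equality)
  have pos: "\<alpha> > 0" "\<beta> > 0" using \<sigma> by (simp_all add: \<alpha>_def \<beta>_def)
  then have gk: "gaussian_kernel \<alpha> \<beta>" by unfold_locales
  have F: "entire ?F"
    by (rule entire_gaussian_integral[OF pos f rapid_cmult[OF rapid_cnj[OF g]]])
  have FW: "?F (\<chi> j. of_real (x $ j), \<chi> j. of_real (k $ j)) = smoothed_wigner \<sigma>x \<sigma>k f g (x, k)" for x k
    unfolding smoothed_wigner_eq[OF \<sigma> f g] \<alpha>_def[symmetric] \<beta>_def[symmetric] c_def[symmetric]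
    by (intro Bochner_Integration.integral_cong refl)
       (auto simp: complex_phase_real[OF gk, symmetric])
  show "entire ?F \<and> (\<forall>x k. ?F (\<chi> j. of_real (x $ j), \<chi> j. of_real (k $ j)) = smoothed_wigner \<sigma>x \<sigma>k f g (x, k))"
    using F FW by blast
  show "G = ?F" if G: "entire G \<and> (\<forall>x k. G (\<chi> j. of_real (x $ j), \<chi> j. of_real (k $ j)) = smoothed_wigner \<sigma>x \<sigma>k f g (x, k))" for G
    by (rule entire_eqI[OF conjunct1[OF G] F]) (simp only: FW G)
qed

text \<open>On the Wigner side the distribution is tested with the Fourier transform of an ambiguity function,
on the Weyl side with the partial Fourier integral computed by \<open>fourier_ambiguity\<close>. These are the same
function.\<close>

theorem smoothed_op_smoothed_wigner:
  fixes f g :: "real^'n::finite \<Rightarrow> complex"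
  assumes \<sigma>: "\<sigma>x > 0" "\<sigma>k > 0" and f: "schwartz f" and g: "rapid g"
  defines "\<alpha> \<equiv> pi * \<sigma>k\<^sup>2 / 2" and "\<beta> \<equiv> 2 * pi / \<sigma>x\<^sup>2" and "c \<equiv> of_real ((sqrt 2 / \<sigma>x) ^ CARD('n))"
  shows "smoothed_op \<sigma>x \<sigma>k L (smoothed_wigner \<sigma>x \<sigma>k f g) (x, k) =
    weyl_op L f (gaussian_kernel.smear \<alpha> \<beta> x k (\<lambda>b. c * cnj (g b)))"
proof -
  interpret gaussian_kernel \<alpha> \<beta> x k
    by unfold_locales (use \<sigma> in \<open>simp_all add: \<alpha>_def \<beta>_def\<close>)
  let ?r = "\<lambda>b. c * cnj (g b)"
  have r: "rapid ?r" by (intro rapid_cmult rapid_cnj g)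
  have amb: "exp (2 * of_real pi * \<i> * of_real (S \<bullet> x + T \<bullet> k)
            - of_real (pi / 2 * (\<sigma>x\<^sup>2 * (norm S)\<^sup>2 + \<sigma>k\<^sup>2 * (norm T)\<^sup>2))) *
       entire_extension (smoothed_wigner \<sigma>x \<sigma>k f g)
         (\<chi> j. of_real (x $ j) + (of_real (T $ j) + \<i> * of_real (\<sigma>x\<^sup>2 * S $ j)) / 2,
          \<chi> j. of_real (k $ j) - (of_real (S $ j) - \<i> * of_real (\<sigma>k\<^sup>2 * T $ j)) / 2)
      = ambiguity f (smear ?r) S T" (is "?E * entire_extension _ ?p = _") for S T
  proof -
    have "?E * entire_extension (smoothed_wigner \<sigma>x \<sigma>k f g) ?p
        = (\<integral>q. ?E * (exp (complex_phase \<alpha> \<beta> ?p q) * (f (fst q) * (c * cnj (g (snd q))))) \<partial>lborel)"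
      unfolding entire_extension_smoothed_wigner[OF \<sigma> schwartz_rapid[OF f] g, folded \<alpha>_def \<beta>_def c_def]
      by (rule integral_mult_right_zero[symmetric])
    also have "\<dots> = (\<integral>q. (case q of (a, b) \<Rightarrow>
        exp (2 * of_real pi * \<i> * of_real (S \<bullet> (a - (1/2) *\<^sub>R T))) * kern (a - T) b * (f a * ?r b)) \<partial>lborel)"
    proof (rule Bochner_Integration.integral_cong[OF refl])
      fix q :: "(real^'n) \<times> (real^'n)"
      obtain a b where q: "q = (a, b)" by (cases q)
      show "?E * (exp (complex_phase \<alpha> \<beta> ?p q) * (f (fst q) * (c * cnj (g (snd q))))) = (case q of (a, b) \<Rightarrow>
        exp (2 * of_real pi * \<i> * of_real (S \<bullet> (a - (1/2) *\<^sub>R T))) * kern (a - T) b * (f a * ?r b))"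
        unfolding q prod.case fst_conv snd_conv mult.assoc[symmetric, of ?E]
          complex_phase_shift[OF \<sigma>, folded \<alpha>_def \<beta>_def] ..
    qed
    also have "\<dots> = ambiguity f (smear ?r) S T"
      by (rule integral_shifted_kern[OF schwartz_rapid[OF f] r])
    finally show ?thesis .
  qed
  have "fourier (\<lambda>(S, T). ambiguity f (smear ?r) S T) = (\<lambda>(X, k). \<integral>z. exp (2 * of_real pi * \<i> * of_real (k \<bullet> z)) *
          f (X - (1/2) *\<^sub>R z) * smear ?r (X + (1/2) *\<^sub>R z) \<partial>lborel)"
    using fourier_ambiguity[OF f smear_schwartz[OF r]] by auto
  then show ?thesis
    unfolding smoothed_op_def fourier_dist_def weyl_op_def prod.case amb by simp
qed


section \<open>Sesquilinearity and time derivatives\<close>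

lemma smoothed_wigner_add_left:
  fixes f1 f2 g :: "real^'n::finite \<Rightarrow> complex"
  assumes "\<sigma>x > 0" "\<sigma>k > 0" and f: "rapid f1" "rapid f2" and g: "rapid g"
  shows "smoothed_wigner \<sigma>x \<sigma>k (\<lambda>a. f1 a + f2 a) g p = smoothed_wigner \<sigma>x \<sigma>k f1 g p + smoothed_wigner \<sigma>x \<sigma>k f2 g p"
proof -
  obtain x k where p: "p = (x, k)" by (cases p)
  interpret gaussian_kernel "pi * \<sigma>k\<^sup>2 / 2" "2 * pi / \<sigma>x\<^sup>2" x k
    by unfold_locales (use assms in simp_all)
  note int = kern_pair_integrable[OF _ rapid_cmult[OF rapid_cnj[OF g]]]
  show ?thesis
    unfolding p smoothed_wigner_eq[OF assms(1,2) rapid_add[OF f] g] smoothed_wigner_eq[OF assms(1,2) f(1) g]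
      smoothed_wigner_eq[OF assms(1,2) f(2) g] Bochner_Integration.integral_add[OF int[OF f(1)] int[OF f(2)], symmetric]
    by (rule Bochner_Integration.integral_cong[OF refl]) (simp add: split_beta distrib_left distrib_right)
qed

lemma smoothed_wigner_cmult_left:
  fixes f g :: "real^'n::finite \<Rightarrow> complex"
  assumes "\<sigma>x > 0" "\<sigma>k > 0" and f: "rapid f" and g: "rapid g"
  shows "smoothed_wigner \<sigma>x \<sigma>k (\<lambda>a. d * f a) g p = d * smoothed_wigner \<sigma>x \<sigma>k f g p"
proof -
  obtain x k where p: "p = (x, k)" by (cases p)
  show ?thesis
    unfolding p smoothed_wigner_eq[OF assms(1,2) rapid_cmult[OF f] g] smoothed_wigner_eq[OF assms(1,2) f(1) g]
      integral_mult_right_zero[symmetric]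
    by (intro Bochner_Integration.integral_cong refl) auto
qed

lemma smoothed_wigner_add_right:
  fixes f g1 g2 :: "real^'n::finite \<Rightarrow> complex"
  assumes \<sigma>: "\<sigma>x > 0" "\<sigma>k > 0" and f: "rapid f" and g: "rapid g1" "rapid g2"
  shows "smoothed_wigner \<sigma>x \<sigma>k f (\<lambda>a. g1 a + g2 a) p = smoothed_wigner \<sigma>x \<sigma>k f g1 p + smoothed_wigner \<sigma>x \<sigma>k f g2 p"
  unfolding smoothed_wigner_commute[OF \<sigma> rapid_add[OF g] f] smoothed_wigner_commute[OF \<sigma> g(1) f]
    smoothed_wigner_commute[OF \<sigma> g(2) f] smoothed_wigner_add_left[OF \<sigma> g f] by simp

lemma smoothed_wigner_cmult_right:
  fixes f g :: "real^'n::finite \<Rightarrow> complex"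
  assumes \<sigma>: "\<sigma>x > 0" "\<sigma>k > 0" and f: "rapid f" and g: "rapid g"
  shows "smoothed_wigner \<sigma>x \<sigma>k f (\<lambda>a. d * g a) p = cnj d * smoothed_wigner \<sigma>x \<sigma>k f g p"
  unfolding smoothed_wigner_commute[OF \<sigma> rapid_cmult[OF g] f] smoothed_wigner_commute[OF \<sigma> g f]
    smoothed_wigner_cmult_left[OF \<sigma> g f] by simp

text \<open>Continuity of the transform in the seminorm \<open>sup (1 + \<bar>x\<bar>)\<^sup>2\<^sup>n \<bar>f x\<bar>\<close> of each argument; the supremum is
replaced by upper bounds \<open>F\<close>, \<open>G\<close>, and \<open>K\<close> does not depend on the functions.\<close>

lemma smoothed_wigner_bound:
  assumes "\<sigma>x > 0" "\<sigma>k > 0"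
  shows "\<exists>K. \<forall>(f :: real^'n::finite \<Rightarrow> complex) g F G. rapid f \<longrightarrow> rapid g \<longrightarrow>
    (\<forall>x. norm (f x) \<le> F / (1 + norm x) ^ (2 * CARD('n))) \<longrightarrow>
    (\<forall>x. norm (g x) \<le> G / (1 + norm x) ^ (2 * CARD('n))) \<longrightarrow>
    norm (smoothed_wigner \<sigma>x \<sigma>k f g p) \<le> K * (F * G)"
proof -
  obtain x k where p: "p = (x, k)" by (cases p)
  interpret gaussian_kernel "pi * \<sigma>k\<^sup>2 / 2" "2 * pi / \<sigma>x\<^sup>2" x k
    by unfold_locales (use assms in simp_all)
  define c where "c = complex_of_real ((sqrt 2 / \<sigma>x) ^ CARD('n))"
  let ?w = "\<lambda>x::real^'n. 1 / (1 + norm x) ^ (2 * CARD('n))"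
  have w: "integrable lborel ?w" using integrable_inverse_power_norm[where 'a="real^'n"] by simp
  have w0: "?w x \<ge> 0" for x by simp
  have ww: "integrable lborel (\<lambda>(a, b). ?w a * ?w b)" by (rule integrable_pair_mult[OF w w])
  define K where "K = norm c * (\<integral>p. (case p of (a, b) \<Rightarrow> ?w a * ?w b) \<partial>lborel)"
  show ?thesis
  proof (intro exI[of _ K] allI impI)
    fix f g :: "real^'n \<Rightarrow> complex" and F G
    assume f: "rapid f" and g: "rapid g"
      and "\<forall>x. norm (f x) \<le> F / (1 + norm x) ^ (2 * CARD('n))"
      and "\<forall>x. norm (g x) \<le> G / (1 + norm x) ^ (2 * CARD('n))"
    then have F: "norm (f x) \<le> F / (1 + norm x) ^ (2 * CARD('n))"
      and G: "norm (g x) \<le> G / (1 + norm x) ^ (2 * CARD('n))" for x by simp_all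
    have F0: "F \<ge> 0" using F[of 0] norm_ge_zero[of "f 0"] by (simp del: norm_ge_zero)
    have "norm (smoothed_wigner \<sigma>x \<sigma>k f g p)
        \<le> (\<integral>p. norm (case p of (a, b) \<Rightarrow> kern a b * (f a * (c * cnj (g b)))) \<partial>lborel)"
      unfolding p smoothed_wigner_eq[OF assms f g] c_def by (rule integral_norm_bound)
    also have "\<dots> \<le> (\<integral>p. norm c * (F * G) * (case p of (a, b) \<Rightarrow> ?w a * ?w b) \<partial>lborel)"
    proof (rule integral_mono)
      show "integrable lborel (\<lambda>p. norm (case p of (a, b) \<Rightarrow> kern a b * (f a * (c * cnj (g b)))))"
        by (intro integrable_norm kern_pair_integrable f rapid_cmult rapid_cnj g)
      show "integrable lborel (\<lambda>p. norm c * (F * G) * (case p of (a, b) \<Rightarrow> ?w a * ?w b))"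
        by (intro integrable_mult_right ww)
      fix q :: "(real^'n) \<times> (real^'n)"
      obtain a b where q: "q = (a, b)" by (cases q)
      have "norm (kern a b * (f a * (c * cnj (g b)))) \<le> 1 * ((F * ?w a) * (norm c * (G * ?w b)))"
        unfolding norm_mult complex_mod_cnj
        using F[of a] G[of b] F0 by (intro mult_mono norm_kern_le_1) auto
      then show "norm (case q of (a, b) \<Rightarrow> kern a b * (f a * (c * cnj (g b))))
          \<le> norm c * (F * G) * (case q of (a, b) \<Rightarrow> ?w a * ?w b)"
        by (simp add: q mult_ac)
    qed
    also have "\<dots> = K * (F * G)" by (simp add: K_def)
    finally show "norm (smoothed_wigner \<sigma>x \<sigma>k f g p) \<le> K * (F * G)" .
  qed
qed

lemma has_vector_derivative_if_remainder_bound: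
  assumes le: "\<And>s. s \<in> I \<Longrightarrow> s \<noteq> t \<Longrightarrow> norm (f s - f t - (s - t) *\<^sub>R D) \<le> \<bar>s - t\<bar> * b s"
    and b: "(b \<longlongrightarrow> 0) (at t within I)"
  shows "(f has_vector_derivative D) (at t within I)"
  unfolding has_vector_derivative_def has_derivative_iff_norm
proof (intro conjI bounded_linear_scaleR_left)
  show "((\<lambda>s. norm (f s - f t - (s - t) *\<^sub>R D) / norm (s - t)) \<longlongrightarrow> 0) (at t within I)"
  proof (rule Lim_null_comparison[OF _ b])
    show "\<forall>\<^sub>F s in at t within I. norm (norm (f s - f t - (s - t) *\<^sub>R D) / norm (s - t)) \<le> b s"
      unfolding eventually_at_filter
      by (rule always_eventually) (use le in \<open>auto simp: divide_le_eq mult.commute\<close>)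
  qed
qed

lemma has_vector_derivative_vecI:
  fixes f :: "real \<Rightarrow> 'a::real_normed_vector^'m::finite"
  assumes "\<And>i. ((\<lambda>s. f s $ i) has_vector_derivative D $ i) (at t within I)"
  shows "(f has_vector_derivative D) (at t within I)"
  unfolding has_vector_derivative_def has_derivative_at_within
proof (intro conjI bounded_linear_scaleR_left vec_tendstoI)
  fix i
  show "((\<lambda>s. ((f s - f t - (s - t) *\<^sub>R D) /\<^sub>R norm (s - t)) $ i) \<longlongrightarrow> 0 $ i) (at t within I)"
    using assms[of i] unfolding has_vector_derivative_def has_derivative_at_within by simp
qed

text \<open>First-order Taylor expansion of a curve at \<open>t\<close>, keeping from the Schwartz topology only weighted sup
norms of the remainder.\<close>

lemma schwartz_C1_remainder:
  fixes v v' :: "real \<Rightarrow> real^'n::finite \<Rightarrow> complex"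
  assumes C1: "schwartz_C1_on I v v'" and t: "t \<in> I"
  obtains r \<rho> where "\<And>s. s \<in> I \<Longrightarrow> rapid (r s)"
    "\<And>s x. s \<noteq> t \<Longrightarrow> v s x = v t x + of_real (s - t) * (v' t x + r s x)"
    "\<And>s x. s \<in> I \<Longrightarrow> norm (r s x) \<le> \<rho> s / (1 + norm x) ^ m"
    "(\<rho> \<longlongrightarrow> 0) (at t within I)"
proof -
  define r where "r s x = (v s x - v t x) / of_real (s - t) - v' t x" for s x
  define \<rho> where "\<rho> s = schwartz_seminorm m [] (r s)" for s
  have v: "schwartz (v s)" "schwartz (v' s)" if "s \<in> I" for s
    using C1 that unfolding schwartz_C1_on_def by blast+
  have r: "rapid (r s)" if s: "s \<in> I" for s
  proof -
    have "rapid (\<lambda>x. inverse (of_real (s - t)) * (v s x + (-1) * v t x) + (-1) * v' t x)"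
      by (intro rapid_add rapid_cmult schwartz_rapid v s t)
    moreover have "r s = (\<lambda>x. inverse (of_real (s - t)) * (v s x + (-1) * v t x) + (-1) * v' t x)"
      by (simp add: r_def fun_eq_iff divide_inverse mult.commute)
    ultimately show ?thesis by simp
  qed
  show ?thesis
  proof (rule that[of r \<rho>])
    show "rapid (r s)" if "s \<in> I" for s by (rule r[OF that])
    show "v s x = v t x + of_real (s - t) * (v' t x + r s x)" if "s \<noteq> t" for s x
      using that by (simp add: r_def)
    show "norm (r s x) \<le> \<rho> s / (1 + norm x) ^ m" if s: "s \<in> I" for s x
    proof -
      have "bdd_above (range (\<lambda>x. (1 + norm x) ^ m * norm (r s x)))"
        using r[OF s] by (auto simp: rapid_def bdd_above_def)
      then have "(1 + norm x) ^ m * norm (r s x) \<le> \<rho> s"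
        unfolding \<rho>_def schwartz_seminorm_def partials.simps by (intro cSUP_upper) auto
      moreover have "(1 + norm x) ^ m > 0" by (intro zero_less_power add_pos_nonneg) auto
      ultimately show ?thesis by (simp add: field_simps)
    qed
    have "schwartz_tendsto (\<lambda>s x. (v s x - v t x) / of_real (s - t)) (v' t) (at t within I)"
      using C1 t unfolding schwartz_C1_on_def by blast
    then have "set ([] :: (real^'n) list) \<subseteq> Basis \<longrightarrow>
        ((\<lambda>s. schwartz_seminorm m [] (\<lambda>x. (v s x - v t x) / of_real (s - t) - v' t x)) \<longlongrightarrow> 0) (at t within I)"
      unfolding schwartz_tendsto_def by blast
    then have "((\<lambda>s. schwartz_seminorm m [] (\<lambda>x. (v s x - v t x) / of_real (s - t) - v' t x)) \<longlongrightarrow> 0) (at t within I)"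
      by simp
    then show "(\<rho> \<longlongrightarrow> 0) (at t within I)" unfolding \<rho>_def r_def .
  qed
qed

text \<open>The product rule for a bounded sesquilinear map: expanding both arguments to first order, all terms
but the two in the claim carry a remainder or an extra factor \<open>s - t\<close>.\<close>

lemma smoothed_wigner_has_vector_derivative:
  fixes v v' w w' :: "real \<Rightarrow> real^'n::finite \<Rightarrow> complex"
  assumes \<sigma>: "\<sigma>x > 0" "\<sigma>k > 0"
    and v: "schwartz_C1_on I v v'" and w: "schwartz_C1_on I w w'" and t: "t \<in> I"
  shows "((\<lambda>s. smoothed_wigner \<sigma>x \<sigma>k (v s) (w s) p) has_vector_derivative
    (smoothed_wigner \<sigma>x \<sigma>k (v' t) (w t) p + smoothed_wigner \<sigma>x \<sigma>k (v t) (w' t) p)) (at t within I)"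
proof -
  let ?N = "2 * CARD('n)"
  define Q where "Q f g = smoothed_wigner \<sigma>x \<sigma>k f g p" for f g :: "real^'n \<Rightarrow> complex"
  obtain K where K: "\<And>f g F G. rapid f \<Longrightarrow> rapid g \<Longrightarrow>
    (\<And>x. norm (f x) \<le> F / (1 + norm x) ^ ?N) \<Longrightarrow> (\<And>x. norm (g x) \<le> G / (1 + norm x) ^ ?N) \<Longrightarrow>
    norm (Q f g) \<le> K * (F * G)"
    using smoothed_wigner_bound[OF \<sigma>, of p] unfolding Q_def by blast
  obtain r \<rho> where r: "\<And>s. s \<in> I \<Longrightarrow> rapid (r s)"
    "\<And>s x. s \<noteq> t \<Longrightarrow> v s x = v t x + of_real (s - t) * (v' t x + r s x)"
    "\<And>s x. s \<in> I \<Longrightarrow> norm (r s x) \<le> \<rho> s / (1 + norm x) ^ ?N" "(\<rho> \<longlongrightarrow> 0) (at t within I)"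
    by (rule schwartz_C1_remainder[OF v t, of ?N]) (rule that)
  obtain q \<theta> where q: "\<And>s. s \<in> I \<Longrightarrow> rapid (q s)"
    "\<And>s x. s \<noteq> t \<Longrightarrow> w s x = w t x + of_real (s - t) * (w' t x + q s x)"
    "\<And>s x. s \<in> I \<Longrightarrow> norm (q s x) \<le> \<theta> s / (1 + norm x) ^ ?N" "(\<theta> \<longlongrightarrow> 0) (at t within I)"
    by (rule schwartz_C1_remainder[OF w t, of ?N]) (rule that)
  have rap: "rapid (v t)" "rapid (v' t)" "rapid (w t)" "rapid (w' t)"
    using v w t unfolding schwartz_C1_on_def by (blast intro: schwartz_rapid)+
  obtain V where V: "\<And>x. norm (v t x) \<le> V / (1 + norm x) ^ ?N" using rapid_boundE[OF rap(1)] by blast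
  obtain V' where V': "\<And>x. norm (v' t x) \<le> V' / (1 + norm x) ^ ?N" using rapid_boundE[OF rap(2)] by blast
  obtain W where W: "\<And>x. norm (w t x) \<le> W / (1 + norm x) ^ ?N" using rapid_boundE[OF rap(3)] by blast
  obtain W' where W': "\<And>x. norm (w' t x) \<le> W' / (1 + norm x) ^ ?N" using rapid_boundE[OF rap(4)] by blast
  define b where "b s = K * (\<rho> s * W) + K * (V * \<theta> s)
      + \<bar>s - t\<bar> * (K * (V' * W') + K * (\<rho> s * W') + K * (V' * \<theta> s) + K * (\<rho> s * \<theta> s))" for s
  have "((\<lambda>s. Q (v s) (w s)) has_vector_derivative (Q (v' t) (w t) + Q (v t) (w' t))) (at t within I)"
  proof (rule has_vector_derivative_if_remainder_bound[where b=b])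
    have "((\<lambda>s. \<bar>s - t\<bar>) \<longlongrightarrow> \<bar>t - t\<bar>) (at t within I)" by (intro tendsto_intros)
    then have "(b \<longlongrightarrow> K * (0 * W) + K * (V * 0)
        + \<bar>t - t\<bar> * (K * (V' * W') + K * (0 * W') + K * (V' * 0) + K * (0 * 0))) (at t within I)"
      unfolding b_def by (intro tendsto_add tendsto_mult tendsto_const r(4) q(4))
    then show "(b \<longlongrightarrow> 0) (at t within I)" by simp
    fix s assume s: "s \<in> I" "s \<noteq> t"
    define d where "d = complex_of_real (s - t)"
    have cnj_d: "cnj d = d" and norm_d: "norm d = \<bar>s - t\<bar>" by (simp_all add: d_def flip: of_real_diff)
    note rs = r(1)[OF s(1)] and qs = q(1)[OF s(1)]
    have vs: "v s = (\<lambda>x. v t x + d * (v' t x + r s x))" and ws: "w s = (\<lambda>x. w t x + d * (w' t x + q s x))"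
      using r(2)[OF s(2)] q(2)[OF s(2)] by (auto simp: d_def)
    have raw: "rapid (w s)" unfolding ws by (intro rapid_add rapid_cmult rap qs)
    have left: "Q (v s) g = Q (v t) g + d * (Q (v' t) g + Q (r s) g)" if g: "rapid g" for g
      unfolding vs Q_def
      by (simp only: smoothed_wigner_add_left[OF \<sigma> rap(1) rapid_cmult[OF rapid_add[OF rap(2) rs]] g]
          smoothed_wigner_cmult_left[OF \<sigma> rapid_add[OF rap(2) rs] g] smoothed_wigner_add_left[OF \<sigma> rap(2) rs g])
    have right: "Q f (w s) = Q f (w t) + d * (Q f (w' t) + Q f (q s))" if f: "rapid f" for f
      unfolding ws Q_def
      by (simp only: smoothed_wigner_add_right[OF \<sigma> f rap(3) rapid_cmult[OF rapid_add[OF rap(4) qs]]]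
          smoothed_wigner_cmult_right[OF \<sigma> f rapid_add[OF rap(4) qs]] smoothed_wigner_add_right[OF \<sigma> f rap(4) qs] cnj_d)
    define E where "E = Q (r s) (w t) + Q (v t) (q s)
      + d * (Q (v' t) (w' t) + Q (r s) (w' t) + Q (v' t) (q s) + Q (r s) (q s))"
    have "Q (v s) (w s) - Q (v t) (w t) - d * (Q (v' t) (w t) + Q (v t) (w' t)) = d * E"
      unfolding left[OF raw] right[OF rap(1)] right[OF rap(2)] right[OF rs] E_def
      by (simp add: algebra_simps)
    then have "norm (Q (v s) (w s) - Q (v t) (w t) - (s - t) *\<^sub>R (Q (v' t) (w t) + Q (v t) (w' t))) = \<bar>s - t\<bar> * norm E"
      unfolding scaleR_conv_of_real d_def[symmetric] by (simp only: norm_mult norm_d)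
    moreover have "norm E \<le> b s"
    proof -
      have dm: "norm (d * X) \<le> \<bar>s - t\<bar> * Y" if "norm X \<le> Y" for X Y
        unfolding norm_mult norm_d using that by (rule mult_left_mono) simp
      note r3 = r(3)[OF s(1)] and q3 = q(3)[OF s(1)]
      show ?thesis
        unfolding E_def b_def
        by (intro norm_triangle_mono dm K[OF rs rap(3) r3 W] K[OF rap(1) qs V q3] K[OF rap(2,4) V' W']
            K[OF rs rap(4) r3 W'] K[OF rap(2) qs V' q3] K[OF rs qs r3 q3])
    qed
    ultimately show "norm (Q (v s) (w s) - Q (v t) (w t) - (s - t) *\<^sub>R (Q (v' t) (w t) + Q (v t) (w' t))) \<le> \<bar>s - t\<bar> * b s"
      by (simp add: mult_left_mono)
  qed
  then show ?thesis unfolding Q_def .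
qed

theorem corollary4p7:
  fixes \<sigma>x \<sigma>k :: real
    and L :: "(('n::finite phase \<Rightarrow> complex) \<Rightarrow> complex)^'d::finite^'d"
    and I :: "real set"
    and u0 :: "real^'n \<Rightarrow> complex^'d"
    and u ut :: "real \<Rightarrow> real^'n \<Rightarrow> complex^'d"
  assumes "\<sigma>x > 0" and "\<sigma>k > 0"
    and "\<And>i j. tempered (L $ i $ j)"
    and "\<And>j. schwartz (\<lambda>x. u0 x $ j)"
    and "is_interval I" and "0 \<in> I"
    and "\<And>j. schwartz_C1_on I (\<lambda>t x. u t x $ j) (\<lambda>t x. ut t x $ j)"
    and "\<And>t i \<phi>. t \<in> I \<Longrightarrow> schwartz \<phi> \<Longrightarrow>
           regular_dist (\<lambda>x. ut t x $ i) \<phi> + (weyl_matrix_op L (u t) $ i) \<phi> = 0"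
    and "\<And>x. u 0 x = u0 x"
  shows "(\<forall>t\<in>I. \<forall>x k. \<exists>Wt.
            ((\<lambda>s. smoothed_wigner_matrix \<sigma>x \<sigma>k (u s) (u s) (x, k)) has_vector_derivative Wt)
              (at t within I) \<and>
            Wt + 2 *\<^sub>R hermitian_part
              (smoothed_matrix_op \<sigma>x \<sigma>k L (smoothed_wigner_matrix \<sigma>x \<sigma>k (u t) (u t)) (x, k)) = 0) \<and>
         (\<forall>x k. smoothed_wigner_matrix \<sigma>x \<sigma>k (u 0) (u 0) (x, k) =
                smoothed_wigner_matrix \<sigma>x \<sigma>k u0 u0 (x, k))"
proof (intro conjI ballI allI)
  note \<sigma> = assms(1,2) and C1 = assms(7) and eqn = assms(8)
  fix t and x k :: "real^'n" assume t: "t \<in> I"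
  define \<alpha> where "\<alpha> = pi * \<sigma>k\<^sup>2 / 2"
  define \<beta> where "\<beta> = 2 * pi / \<sigma>x\<^sup>2"
  define c where "c = complex_of_real ((sqrt 2 / \<sigma>x) ^ CARD('n))"
  interpret gaussian_kernel \<alpha> \<beta> x k
    by unfold_locales (use \<sigma> in \<open>simp_all add: \<alpha>_def \<beta>_def\<close>)
  let ?u = "\<lambda>i x. u t x $ i" and ?ut = "\<lambda>i x. ut t x $ i"
  let ?W = "smoothed_wigner \<sigma>x \<sigma>k"
  define M where "M = smoothed_matrix_op \<sigma>x \<sigma>k L (smoothed_wigner_matrix \<sigma>x \<sigma>k (u t) (u t)) (x, k)"
  have sch: "schwartz (?u i)" "schwartz (?ut i)" for i
    using C1[of i] t unfolding schwartz_C1_on_def by blast+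
  note rap = sch[THEN schwartz_rapid]
  \<comment> \<open>The equation tested with the window of the j-th component of the solution.\<close>
  have W_ut: "?W (?ut i) (?u j) (x, k) = - M $ i $ j" for i j
  proof -
    let ?r = "\<lambda>b. c * cnj (u t b $ j)"
    have r: "rapid ?r" by (intro rapid_cmult rapid_cnj rap)
    have "?W (?ut i) (?u j) (x, k) = regular_dist (?ut i) (smear ?r)"
      unfolding smoothed_wigner_eq[OF \<sigma> rap(2) rap(1)] \<alpha>_def[symmetric] \<beta>_def[symmetric] c_def[symmetric]
        integral_mult_smear[OF rap(2) r] regular_dist_def ..
    also have "\<dots> = - (\<Sum>l\<in>UNIV. weyl_op (L $ i $ l) (?u l) (smear ?r))"
      using eqn[OF t smear_schwartz[OF r], of i] by (simp add: weyl_matrix_op_def add_eq_0_iff2)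
    also have "(\<Sum>l\<in>UNIV. weyl_op (L $ i $ l) (?u l) (smear ?r)) = M $ i $ j"
      using smoothed_op_smoothed_wigner[OF \<sigma> sch(1) rap(1), folded \<alpha>_def \<beta>_def c_def]
      by (simp add: M_def smoothed_matrix_op_def smoothed_wigner_matrix_def \<alpha>_def \<beta>_def c_def)
    finally show ?thesis .
  qed
  define Wt where "Wt = (\<chi> i j. ?W (?ut i) (?u j) (x, k) + ?W (?u i) (?ut j) (x, k))"
  have "((\<lambda>s. smoothed_wigner_matrix \<sigma>x \<sigma>k (u s) (u s) (x, k)) has_vector_derivative Wt) (at t within I)"
    by (intro has_vector_derivative_vecI)
       (simp add: Wt_def smoothed_wigner_matrix_def smoothed_wigner_has_vector_derivative[OF \<sigma> C1 C1 t])
  moreover have "Wt + 2 *\<^sub>R hermitian_part M = 0"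
  proof -
    have "?W (?u i) (?ut j) (x, k) = - cnj (M $ j $ i)" for i j
      unfolding smoothed_wigner_commute[OF \<sigma> rap(2) rap(1)] W_ut by simp
    then show ?thesis
      by (simp add: vec_eq_iff Wt_def W_ut hermitian_part_def adjoint_matrix_def)
  qed
  ultimately show "\<exists>Wt. ((\<lambda>s. smoothed_wigner_matrix \<sigma>x \<sigma>k (u s) (u s) (x, k)) has_vector_derivative Wt)
              (at t within I) \<and>
            Wt + 2 *\<^sub>R hermitian_part
              (smoothed_matrix_op \<sigma>x \<sigma>k L (smoothed_wigner_matrix \<sigma>x \<sigma>k (u t) (u t)) (x, k)) = 0"
    unfolding M_def by blast
next
  fix x k :: "real^'n"
  have "u 0 = u0" using assms(9) by auto
  then show "smoothed_wigner_matrix \<sigma>x \<sigma>k (u 0) (u 0) (x, k) = smoothed_wigner_matrix \<sigma>x \<sigma>k u0 u0 (x, k)"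
    by simp
qed

end
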